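(* Let $G=(V,E)$ be a connected graph. Then $\mathcal{H}_3(G)$ is Mengerian if and only if $|V|=4$, or $G=C_8$ (the cycle on $8$ vertices), or $G$ is a path with double stars, or $G$ is a star with an additional edge between two of its leaves.
   Context: All graphs are finite, simple and undirected; as a standing assumption $|V|\ge 4$. For a graph $G$, $\mathcal{H}_3(G)$ is the $4$-uniform hypergraph on $V(G)$ whose hyperedges are the $4$-element subsets of $V(G)$ that contain a path of length $3$ in $G$ (the vertices can be ordered $v_1,\dots,v_4$ with $\{v_i,v_{i+1}\}\in E(G)$ for $i=1,2,3$). A tree $T$ is a path with double stars if at most two vertices of $T$ are adjacent to leaves (this includes stars and paths). A star with an additional edge between two of its leaves is $K_{1,n}$ with one extra edge joining two of its leaves. A clutter with incidence matrix $A$ on $n$ vertices is Mengerian if for every $c\in\mathbb{Z}_{\ge0}^n$, $\min\{\langle c,x\rangle: x\ge0 \text{ integral}, Ax\ge\mathbf 1\}=\max\{\langle y,\mathbf 1\rangle : y\ge 0\text{ integral}, y^\top A\le c^\top\}$ (equivalently, its edge ideal is normally torsion-free); the empty clutter is Mengerian. *)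

theory Defs
  imports "Graph_Theory.Graph_Theory"
begin

text \<open>A finite simple undirected graph is a \<^term>\<open>pair_graph\<close>: a finite, loop-free digraph with a
  symmetric arc set, so that the edge \<open>{u, v}\<close> is the pair of arcs \<open>(u, v)\<close>, \<open>(v, u)\<close>.\<close>

definition H3 :: "'a pair_pre_digraph \<Rightarrow> 'a set set" where
  "H3 G = {e. e \<subseteq> pverts G \<and> card e = 4 \<and>
              (\<exists>p. vpath p (with_proj G) \<and> vwalk_length p = 3 \<and> set p \<subseteq> e)}"

text \<open>The library's \<open>forest\<close> and \<open>tree\<close> are directed notions: in a symmetric digraph every edge
  is already a directed cycle of length 2. Cycles of an undirected graph have length at least 3.\<close>

definition undirected_tree :: "'a pair_pre_digraph \<Rightarrow> bool" where
  "undirected_tree G \<longleftrightarrow> pair_graph G \<and> Digraph_Component.connected (with_proj G) \<and>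
     \<not> (\<exists>p. pre_digraph.cycle (with_proj G) p \<and> length p \<ge> 3)"

definition leaf :: "'a pair_pre_digraph \<Rightarrow> 'a \<Rightarrow> bool" where
  "leaf G v \<longleftrightarrow> v \<in> pverts G \<and> out_degree (with_proj G) v = 1"

definition path_with_double_stars :: "'a pair_pre_digraph \<Rightarrow> bool" where
  "path_with_double_stars G \<longleftrightarrow> undirected_tree G \<and>
     card {v \<in> pverts G. \<exists>l. leaf G l \<and> (v, l) \<in> parcs G} \<le> 2"

definition star_with_extra_edge :: "'a pair_pre_digraph \<Rightarrow> bool" where
  "star_with_extra_edge G \<longleftrightarrow>
     (\<exists>S n a b. complete_bipartite_digraph 1 n (with_proj S) \<and>
        leaf S a \<and> leaf S b \<and> a \<noteq> b \<and> (a, b) \<notin> parcs S \<and>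
        pverts G = pverts S \<and> parcs G = parcs S \<union> {(a, b), (b, a)})"

definition cycle_graph :: "nat \<Rightarrow> nat pair_pre_digraph" where
  "cycle_graph n = \<lparr> pverts = {..<n},
     parcs = {(i, j). i < n \<and> j < n \<and> (j = Suc i mod n \<or> i = Suc j mod n)} \<rparr>"

text \<open>Rows of the incidence matrix are indexed by the hyperedges, columns by the vertices;
  nonnegative integral vectors are functions into \<^typ>\<open>nat\<close>.\<close>

definition incidence :: "'a set \<Rightarrow> 'a \<Rightarrow> nat" where
  "incidence e v = (if v \<in> e then 1 else 0)"

definition integral_cover :: "'a set \<Rightarrow> 'a set set \<Rightarrow> ('a \<Rightarrow> nat) \<Rightarrow> bool" where
  "integral_cover V F x \<longleftrightarrow> (\<forall>e\<in>F. (\<Sum>v\<in>V. incidence e v * x v) \<ge> 1)"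

definition integral_packing ::
    "'a set \<Rightarrow> 'a set set \<Rightarrow> ('a \<Rightarrow> nat) \<Rightarrow> ('a set \<Rightarrow> nat) \<Rightarrow> bool" where
  "integral_packing V F c y \<longleftrightarrow> (\<forall>v\<in>V. (\<Sum>e\<in>F. y e * incidence e v) \<le> c v)"

definition mengerian :: "'a set \<Rightarrow> 'a set set \<Rightarrow> bool" where
  "mengerian V F \<longleftrightarrow>
     (\<forall>c :: 'a \<Rightarrow> nat. \<exists>x y.
        is_arg_min (\<lambda>x. \<Sum>v\<in>V. c v * x v) (integral_cover V F) x \<and>
        is_arg_max (\<lambda>y. \<Sum>e\<in>F. y e) (integral_packing V F c) y \<and>
        (\<Sum>v\<in>V. c v * x v) = (\<Sum>e\<in>F. y e))"

end

theory Submission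
  imports Defs
begin

text \<open>In a path with double stars, in a star with an extra edge and in a graph on four vertices the
  hyperedges are the transversals of four consecutive layers of a layering of the vertices, and
  for such interval structures a minimum cover and a maximum packing of equal value come from a
  shortest-path potential. For the eight-cycle one peels off suitable windows one at a time.

  Conversely, all other graphs have a minor of odd-cycle type. Five vertices of which three
  four-subsets are hyperedges give a triangle minor; this excludes four-cycles and leaves only stars
  with an extra edge among the graphs with a triangle. An induced cycle of length \<open>n \<ge> 5\<close> has covering
  number at least \<open>n / 4\<close> and packing number at most \<open>n / 4\<close>, which excludes all \<open>n\<close> not divisible by 4;
  for \<open>4 dvd n\<close> and \<open>n \<ge> 12\<close> a contraction is an odd cycle. A vertex attached to the middle of an
  induced path on five vertices again gives a triangle minor; this excludes proper supergraphs of the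
  eight-cycle and trees with three vertices adjacent to leaves.\<close>

subsection \<open>Covers and packings\<close>

text \<open>Positive results are certificates: for every weight vector a cover and a packing of
  equal value are exhibited, and weak duality makes both optimal. Negative results exhibit one bad
  weight vector; no minor is ever formed as a hypergraph of its own. Weight 0 bars a vertex from
  every packed hyperedge, which deletes it; a weight above the optimum bars it from every optimal
  cover, which contracts it. What remains is a cyclic system of \<open>N\<close> windows of length
  \<open>k\<close>, whose fractional optimum \<open>N / k\<close> is not an integer. Four vertices
  are exceptional because there is at most one hyperedge, while the obstruction from a four-cycle
  needs a fifth vertex attached to it. For trees, being Mengerian and having at most two vertices
  adjacent to leaves are not compared directly: each is matched with the shape of the tree around
  one longest path.\<close>

lemma weak_duality:
  assumes x: "integral_cover V F x" and y: "integral_packing V F c y"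
  shows "(\<Sum>e\<in>F. y e) \<le> (\<Sum>v\<in>V. c v * x v)"
proof -
  have "(\<Sum>e\<in>F. y e) \<le> (\<Sum>e\<in>F. y e * (\<Sum>v\<in>V. incidence e v * x v))"
    using x by (intro sum_mono) (auto simp: integral_cover_def)
  also have "\<dots> = (\<Sum>v\<in>V. (\<Sum>e\<in>F. y e * incidence e v) * x v)"
    by (simp add: sum_distrib_left sum_distrib_right mult.assoc) (rule sum.swap)
  also have "\<dots> \<le> (\<Sum>v\<in>V. c v * x v)"
    using y by (intro sum_mono mult_right_mono) (auto simp: integral_packing_def)
  finally show ?thesis .
qed

text \<open>By weak duality a cover that costs no more than some packing certifies that both are
  optimal, so neither optimum has to be determined separately.\<close>

lemma mengerianI:
  assumes "\<And>c. \<exists>x y. integral_cover V F x \<and> integral_packing V F c y \<and>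
                 (\<Sum>v\<in>V. c v * x v) \<le> (\<Sum>e\<in>F. y e)"
  shows "mengerian V F"
  unfolding mengerian_def
proof
  fix c
  obtain x y where *: "integral_cover V F x" "integral_packing V F c y"
      "(\<Sum>v\<in>V. c v * x v) \<le> (\<Sum>e\<in>F. y e)"
    using assms by blast
  have "(\<Sum>v\<in>V. c v * x v) \<le> (\<Sum>v\<in>V. c v * x' v)" if "integral_cover V F x'" for x'
    using *(3) weak_duality[OF that *(2)] by linarith
  moreover have "(\<Sum>e\<in>F. y' e) \<le> (\<Sum>e\<in>F. y e)" if "integral_packing V F c y'" for y'
    using *(3) weak_duality[OF *(1) that] weak_duality[OF *(1,2)] by linarith
  moreover have "(\<Sum>v\<in>V. c v * x v) = (\<Sum>e\<in>F. y e)"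
    using *(3) weak_duality[OF *(1,2)] by linarith
  ultimately show "\<exists>x y. is_arg_min (\<lambda>x. \<Sum>v\<in>V. c v * x v) (integral_cover V F) x \<and>
        is_arg_max (\<lambda>y. \<Sum>e\<in>F. y e) (integral_packing V F c) y \<and>
        (\<Sum>v\<in>V. c v * x v) = (\<Sum>e\<in>F. y e)"
    using *(1,2) by (intro exI[of _ x] exI[of _ y]) (auto simp: is_arg_min_def is_arg_max_def not_less)
qed

lemma mengerianD:
  assumes "mengerian V F"
  obtains x y where "integral_cover V F x" "integral_packing V F c y"
    "(\<Sum>v\<in>V. c v * x v) = (\<Sum>e\<in>F. y e)"
  using assms unfolding mengerian_def is_arg_min_def is_arg_max_def by metis

lemma mengerian_empty: "mengerian V {}"
  by (rule mengerianI, rule exI[of _ "\<lambda>_. 0"]) (auto simp: integral_cover_def integral_packing_def)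

lemma integral_cover_indicator:
  assumes "finite V" "\<And>e. e \<in> F \<Longrightarrow> \<exists>v\<in>e. v \<in> V \<and> v \<in> X"
  shows "integral_cover V F (\<lambda>v. if v \<in> X then 1 else 0)"
  unfolding integral_cover_def
proof
  fix e assume "e \<in> F"
  then obtain v where "v \<in> e" "v \<in> V" "v \<in> X" using assms by blast
  then have "1 \<le> incidence e v * (if v \<in> X then 1 else 0)" by (simp add: incidence_def)
  also have "\<dots> \<le> (\<Sum>v\<in>V. incidence e v * (if v \<in> X then 1 else 0))"
    using \<open>v \<in> V\<close> assms(1) by (intro member_le_sum) auto
  finally show "1 \<le> (\<Sum>v\<in>V. incidence e v * (if v \<in> X then 1 else 0))" .
qed

text \<open>Different indices may name the same hyperedge; the packing adds up the multiplicities
  over each fibre of \<open>E\<close>. Loads can therefore be counted on indices, without asking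
  which hyperedges coincide.\<close>

lemma indexed_packing:
  fixes z :: "'i \<Rightarrow> nat"
  assumes "finite F" "finite I" "E ` I \<subseteq> F"
    and le: "\<And>v. v \<in> V \<Longrightarrow> (\<Sum>i\<in>{i\<in>I. v \<in> E i}. z i) \<le> c v"
  shows "\<exists>y. integral_packing V F c y \<and> (\<Sum>e\<in>F. y e) = (\<Sum>i\<in>I. z i)"
proof -
  define y where "y e = (\<Sum>i\<in>{i\<in>I. E i = e}. z i)" for e
  have tot: "(\<Sum>e\<in>F. \<Sum>i\<in>{i\<in>I. E i = e}. g i) = (\<Sum>i\<in>I. g i)" for g :: "'i \<Rightarrow> nat"
    using assms(1-3) by (intro sum.group) auto
  have "(\<Sum>e\<in>F. y e * incidence e v) = (\<Sum>i\<in>{i\<in>I. v \<in> E i}. z i)" for v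
  proof -
    have "(\<Sum>e\<in>F. y e * incidence e v) = (\<Sum>e\<in>F. \<Sum>i\<in>{i\<in>I. E i = e}. z i * incidence (E i) v)"
      by (auto simp: y_def sum_distrib_right intro!: sum.cong)
    also have "\<dots> = (\<Sum>i\<in>I. z i * incidence (E i) v)" by (rule tot)
    also have "\<dots> = (\<Sum>i\<in>{i\<in>I. v \<in> E i}. z i)"
      using assms(2) by (intro sum.mono_neutral_cong_right) (auto simp: incidence_def)
    finally show ?thesis .
  qed
  then have "integral_packing V F c y" using le by (simp add: integral_packing_def)
  moreover have "(\<Sum>e\<in>F. y e) = (\<Sum>i\<in>I. z i)" unfolding y_def by (rule tot)
  ultimately show ?thesis by blast
qed

text \<open>Split every \<open>v\<close> into \<open>c v\<close> slots. There are enough slots for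
  an injection of \<open>U\<close>, and forgetting the slot number gives the assignment.\<close>

lemma capacitated_assignment:
  assumes "finite U" "finite L" "card U \<le> (\<Sum>v\<in>L. c v)"
  shows "\<exists>\<phi>. \<phi> ` U \<subseteq> L \<and> (\<forall>v\<in>L. card {u\<in>U. \<phi> u = v} \<le> c v)"
proof -
  let ?S = "Sigma L (\<lambda>v. {..<c v})"
  have fS: "finite ?S" using assms(2) by auto
  have "card ?S = (\<Sum>v\<in>L. c v)" using assms(2) by simp
  then obtain g where g: "g ` U \<subseteq> ?S" "inj_on g U"
    using assms(1,3) fS by (metis card_le_inj)
  have "card {u\<in>U. fst (g u) = v} \<le> c v" if "v \<in> L" for v
  proof -
    have "card {u\<in>U. fst (g u) = v} = card (g ` {u\<in>U. fst (g u) = v})"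
      using g(2) by (intro card_image[symmetric]) (auto simp: inj_on_def)
    also have "\<dots> \<le> card ({v} \<times> {..<c v})"
      using g(1) by (intro card_mono) auto
    finally show ?thesis by simp
  qed
  then show ?thesis using g(1) by (intro exI[of _ "fst \<circ> g"]) auto
qed

subsection \<open>Consecutive layers\<close>

definition hits_windows :: "nat \<Rightarrow> nat \<Rightarrow> nat set \<Rightarrow> bool" where
  "hits_windows k n X \<longleftrightarrow> X \<subseteq> {..<n} \<and> (\<forall>i. i + k \<le> n \<longrightarrow> X \<inter> {i..<i + k} \<noteq> {})"

definition min_hit_weight :: "nat \<Rightarrow> (nat \<Rightarrow> nat) \<Rightarrow> nat \<Rightarrow> nat" where
  "min_hit_weight k w n = (LEAST s. \<exists>X. hits_windows k n X \<and> sum w X = s)"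

lemma min_hit_weight_attained:
  assumes "k > 0"
  shows "\<exists>X. hits_windows k n X \<and> sum w X = min_hit_weight k w n"
proof -
  have "hits_windows k n {..<n}"
  proof -
    have "i \<in> {..<n} \<inter> {i..<i + k}" if "i + k \<le> n" for i using that assms by auto
    then show ?thesis unfolding hits_windows_def by blast
  qed
  then show ?thesis unfolding min_hit_weight_def
    by (intro LeastI[of "\<lambda>s. \<exists>X. hits_windows k n X \<and> sum w X = s"]) blast
qed

lemma min_hit_weight_le: "hits_windows k n X \<Longrightarrow> min_hit_weight k w n \<le> sum w X"
  unfolding min_hit_weight_def by (rule Least_le) blast

lemma min_hit_weight_short: "n < k \<Longrightarrow> min_hit_weight k w n = 0"
  using min_hit_weight_le[of k n "{}" w] by (simp add: hits_windows_def)

lemma min_hit_weight_mono: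
  assumes "k > 0" "m \<le> n"
  shows "min_hit_weight k w m \<le> min_hit_weight k w n"
proof -
  obtain X where X: "hits_windows k n X" "sum w X = min_hit_weight k w n"
    using min_hit_weight_attained[OF assms(1)] by blast
  have "finite X" using X(1) by (auto simp: hits_windows_def intro: finite_subset)
  have "hits_windows k m (X \<inter> {..<m})"
    unfolding hits_windows_def
  proof (intro conjI allI impI)
    fix i assume i: "i + k \<le> m"
    then have "X \<inter> {i..<i+k} \<noteq> {}" using X(1) assms(2) by (auto simp: hits_windows_def)
    moreover have "{i..<i+k} \<subseteq> {..<m}" using i by auto
    ultimately show "X \<inter> {..<m} \<inter> {i..<i+k} \<noteq> {}" by blast
  qed simp
  then have "min_hit_weight k w m \<le> sum w (X \<inter> {..<m})" by (rule min_hit_weight_le)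
  also have "\<dots> \<le> sum w X" using \<open>finite X\<close> by (intro sum_mono2) auto
  finally show ?thesis using X(2) by simp
qed

text \<open>Adding \<open>j\<close> to a set that hits all windows inside \<open>{..<j}\<close> is
  enough up to \<open>j + k\<close>: each further window ends beyond \<open>j\<close> and starts at
  \<open>j\<close> or earlier, so it contains \<open>j\<close>. This inequality is what bounds the
  load on layer \<open>j\<close>.\<close>

lemma min_hit_weight_step:
  assumes "k > 0"
  shows "min_hit_weight k w (j + k) \<le> min_hit_weight k w j + w j"
proof -
  obtain X where X: "hits_windows k j X" "sum w X = min_hit_weight k w j"
    using min_hit_weight_attained[OF assms(1)] by blast
  have fX: "finite X" "j \<notin> X" using X(1) by (auto simp: hits_windows_def intro: finite_subset)
  have "hits_windows k (j + k) (insert j X)"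
    unfolding hits_windows_def
  proof (intro conjI allI impI)
    show "insert j X \<subseteq> {..<j + k}" using X(1) assms by (auto simp: hits_windows_def)
    fix i assume i: "i + k \<le> j + k"
    show "insert j X \<inter> {i..<i+k} \<noteq> {}"
    proof (cases "i + k \<le> j")
      case True then show ?thesis using X(1) by (auto simp: hits_windows_def)
    next
      case False
      then have "j \<in> {i..<i+k}" using i by auto
      then show ?thesis by blast
    qed
  qed
  then have "min_hit_weight k w (j + k) \<le> sum w (insert j X)" by (rule min_hit_weight_le)
  then show ?thesis using fX X(2) by simp
qed

lemma sum_increments:
  fixes f :: "nat \<Rightarrow> nat"
  assumes "\<And>m n. m \<le> n \<Longrightarrow> f m \<le> f n" "a \<le> b"
  shows "(\<Sum>n\<in>{a..<b}. f (Suc n) - f n) = f b - f a"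
  using assms(2)
proof (induction b rule: dec_induct)
  case (step n)
  then show ?case using assms(1)[of a n] assms(1)[of n "Suc n"] by simp
qed simp

text \<open>With \<open>f n\<close> the least weight of a set hitting every window inside \<open>{..<n}\<close>, the packing takes
  the window ending at \<open>n\<close> exactly \<open>f (n + 1) - f n\<close> times; the load on layer \<open>j\<close> telescopes to
  \<open>f (j + k) - f j\<close>, which is at most the weight of that layer because \<open>j\<close> hits every window
  between. The copies are then distributed over the vertices of the layer.\<close>

lemma mengerian_windows:
  fixes pos :: "'a \<Rightarrow> nat"
  assumes "finite V" "k > 0"
  shows "mengerian V {e. e \<subseteq> V \<and> (\<exists>i. bij_betw pos e {i..<i + k})}" (is "mengerian V ?F")
proof (rule mengerianI)
  fix c :: "'a \<Rightarrow> nat"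
  have fF: "finite ?F" using assms(1) by (auto intro: finite_subset[of _ "Pow V"])
  define L where "L j = {v\<in>V. pos v = j}" for j
  define w where "w j = (\<Sum>v\<in>L j. c v)" for j
  define f where "f = min_hit_weight k w"
  have fmono: "m \<le> n \<Longrightarrow> f m \<le> f n" for m n
    unfolding f_def using min_hit_weight_mono[OF assms(2)] .
  obtain M where M: "\<And>v. v \<in> V \<Longrightarrow> pos v < M"
    using finite_nat_set_iff_bounded[of "pos ` V"] assms(1) by auto
  define z where "z i = f (i + k) - f (i + k - 1)" for i
  \<comment> \<open>A pair \<open>(i, t)\<close> in \<open>U\<close> stands for copy number
    \<open>t\<close> of the window starting at \<open>i\<close>; \<open>Uj j\<close> collects the
    copies whose window covers layer \<open>j\<close>.\<close>
  define U where "U = Sigma {..<M} (\<lambda>i. {..<z i})"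
  define Uj where "Uj j = {u\<in>U. fst u \<le> j \<and> j < fst u + k}" for j
  have fU: "finite U" unfolding U_def by auto
  have "card (Uj j) \<le> w j" for j
  proof -
    have "Uj j = Sigma {i. i < M \<and> i \<le> j \<and> j < i + k} (\<lambda>i. {..<z i})"
      by (auto simp: Uj_def U_def)
    then have "card (Uj j) = (\<Sum>i\<in>{i. i < M \<and> i \<le> j \<and> j < i + k}. z i)" by simp
    also have "\<dots> = (\<Sum>n\<in>(\<lambda>i. i + k - 1) ` {i. i < M \<and> i \<le> j \<and> j < i + k}. f (Suc n) - f n)"
      using assms(2) by (subst sum.reindex) (auto simp: inj_on_def z_def)
    also have "\<dots> \<le> (\<Sum>n\<in>{j..<j+k}. f (Suc n) - f n)"
      by (intro sum_mono2) auto
    also have "\<dots> = f (j + k) - f j" by (rule sum_increments[OF fmono]) auto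
    also have "\<dots> \<le> w j" using min_hit_weight_step[OF assms(2), of w j] by (simp add: f_def)
    finally show ?thesis .
  qed
  then have "\<exists>\<phi>. \<phi> ` Uj j \<subseteq> L j \<and> (\<forall>v\<in>L j. card {u\<in>Uj j. \<phi> u = v} \<le> c v)" for j
    unfolding w_def using fU assms(1) by (intro capacitated_assignment) (auto simp: Uj_def L_def)
  then obtain \<phi> where \<phi>: "\<And>j. \<phi> j ` Uj j \<subseteq> L j"
      "\<And>j v. v \<in> L j \<Longrightarrow> card {u\<in>Uj j. \<phi> j u = v} \<le> c v"
    by metis
  \<comment> \<open>Each layer has assigned its copies on its own. Any choice of one vertex per
    layer is a hyperedge, so the independent choices fit together.\<close>
  define E where "E u = (\<lambda>j. \<phi> j u) ` {fst u..<fst u + k}" for u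
  have \<phi>L: "\<phi> j u \<in> L j" if "u \<in> U" "j \<in> {fst u..<fst u + k}" for u j
    using \<phi>(1)[of j] that by (auto simp: Uj_def)
  have EF: "E ` U \<subseteq> ?F"
  proof clarify
    fix i t assume u: "(i, t) \<in> U"
    have "bij_betw pos (E (i, t)) {i..<i+k}"
      by (rule bij_betw_byWitness[where f' = "\<lambda>j. \<phi> j (i,t)"])
        (use \<phi>L[OF u] in \<open>auto simp: E_def L_def\<close>)
    moreover have "E (i, t) \<subseteq> V" using \<phi>L[OF u] by (auto simp: E_def L_def)
    ultimately show "E (i, t) \<subseteq> V \<and> (\<exists>i'. bij_betw pos (E (i, t)) {i'..<i'+k})" by blast
  qed
  have "\<exists>y. integral_packing V ?F c y \<and> (\<Sum>e\<in>?F. y e) = (\<Sum>u\<in>U. 1)"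
  proof (rule indexed_packing[OF fF fU EF])
    fix v assume v: "v \<in> V"
    have "{u\<in>U. v \<in> E u} \<subseteq> {u\<in>Uj (pos v). \<phi> (pos v) u = v}"
      using \<phi>L by (fastforce simp: E_def L_def Uj_def)
    then have "card {u\<in>U. v \<in> E u} \<le> card {u\<in>Uj (pos v). \<phi> (pos v) u = v}"
      using fU by (intro card_mono) (auto simp: Uj_def)
    also have "\<dots> \<le> c v" using v by (intro \<phi>(2)) (simp add: L_def)
    finally show "(\<Sum>u\<in>{u\<in>U. v \<in> E u}. 1) \<le> c v" by simp
  qed
  then obtain y where y: "integral_packing V ?F c y" "(\<Sum>e\<in>?F. y e) = card U" by auto
  have "card U = (\<Sum>i<M. z i)" by (simp add: U_def)
  also have "\<dots> = (\<Sum>n\<in>{k - 1..<M + k - 1}. f (Suc n) - f n)"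
    by (rule sum.reindex_bij_witness[of _ "\<lambda>n. n - (k - 1)" "\<lambda>i. i + k - 1"])
       (use assms(2) in \<open>auto simp: z_def\<close>)
  also have "\<dots> = f (M + k - 1) - f (k - 1)" using assms(2) by (intro sum_increments[OF fmono]) auto
  also have "\<dots> = f (M + k - 1)" using assms(2) by (simp add: f_def min_hit_weight_short)
  finally have U: "card U = f (M + k - 1)" .
  obtain X where X: "hits_windows k (M + k - 1) X" "sum w X = f (M + k - 1)"
    unfolding f_def using min_hit_weight_attained[OF assms(2)] by blast
  have fX: "finite X" using X(1) by (auto simp: hits_windows_def intro: finite_subset)
  have "integral_cover V ?F (\<lambda>v. if v \<in> pos -` X then 1 else 0)"
  proof (rule integral_cover_indicator[OF assms(1)])
    fix e assume "e \<in> ?F"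
    then obtain i where e: "e \<subseteq> V" "bij_betw pos e {i..<i+k}" by blast
    have im: "pos ` e = {i..<i+k}" using e(2) by (rule bij_betw_imp_surj_on)
    then have "i \<in> pos ` e" using assms(2) by auto
    \<comment> \<open>A hyperedge has a vertex in its lowest layer, so only windows starting below
      \<open>M\<close> occur, and these lie inside \<open>{..<M + k - 1}\<close>.\<close>
    then have "i < M" using M e(1) by auto
    then have "X \<inter> {i..<i+k} \<noteq> {}" using X(1) by (auto simp: hits_windows_def)
    then obtain j where "j \<in> X" "j \<in> pos ` e" using im by blast
    then show "\<exists>v\<in>e. v \<in> V \<and> v \<in> pos -` X" using e(1) by blast
  qed
  moreover have "(\<Sum>v\<in>V. c v * (if v \<in> pos -` X then 1 else 0)) = sum w X"
  proof -
    have "(\<Sum>v\<in>V. c v * (if v \<in> pos -` X then 1 else 0)) = (\<Sum>v\<in>{v\<in>V. pos v \<in> X}. c v)"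
      using assms(1) by (intro sum.mono_neutral_cong_right) auto
    also have "\<dots> = (\<Sum>j\<in>X. \<Sum>v\<in>{v\<in>{v\<in>V. pos v \<in> X}. pos v = j}. c v)"
      using assms(1) fX by (intro sum.group[symmetric]) auto
    also have "\<dots> = sum w X" by (auto simp: w_def L_def intro!: sum.cong)
    finally show ?thesis .
  qed
  ultimately show "\<exists>x y. integral_cover V ?F x \<and> integral_packing V ?F c y \<and>
      (\<Sum>v\<in>V. c v * x v) \<le> (\<Sum>e\<in>?F. y e)"
    using y(1) by (intro exI conjI) (assumption, assumption, simp add: y(2) U X(2))
qed

subsection \<open>The eight-cycle\<close>

lemma periodic_mod_eq:
  fixes f :: "int \<Rightarrow> 'b"
  assumes per: "\<And>i. f (i + n) = f i" and "i mod n = j mod n"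
  shows "f i = f j"
proof -
  have up: "f (i + n * int m) = f i" for i m
  proof (induction m)
    case (Suc m)
    then show ?case using per[of "i + n * int m"] by (simp add: algebra_simps)
  qed simp
  obtain k where k: "i = j + n * k" using assms(2) by (metis mod_eqE)
  show ?thesis
  proof (cases "k \<ge> 0")
    case True then show ?thesis using up[of j "nat k"] k by simp
  next
    case False then show ?thesis using up[of i "nat (- k)"] k by simp
  qed
qed

text \<open>The minimal covers of the eight windows are the pairs \<open>{i, i + 4}\<close> and the triples
  \<open>{a, a + 3, a + 6}\<close>. Every window meets every pair once, and the window at \<open>s\<close> meets twice exactly the
  triples with \<open>a - s \<in> {0, 2, 3, 5}\<close>. So removing one copy of a window that lies in the support of \<open>c\<close>
  and for which these four triples are not tight lowers the covering number by only one. If all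
  \<open>c i\<close> are positive and the triple at \<open>a\<close> is tight, the window at \<open>a + 4\<close> works.\<close>

lemma C8_peel_window:
  fixes c :: "int \<Rightarrow> nat"
  defines "T \<equiv> \<lambda>a. c a + c (a + 3) + c (a + 6)"
  assumes per: "\<And>i. c (i + 8) = c i" and t: "0 < t"
    and pair: "\<And>i. t \<le> c i + c (i + 4)" and triple: "\<And>a. t \<le> T a"
  shows "\<exists>s. 0 < c s \<and> 0 < c (s + 1) \<and> 0 < c (s + 2) \<and> 0 < c (s + 3) \<and>
             t < T s \<and> t < T (s + 2) \<and> t < T (s + 3) \<and> t < T (s + 5)"
proof (rule ccontr)
  assume "\<not> ?thesis"
  then have no: "c s = 0 \<or> c (s + 1) = 0 \<or> c (s + 2) = 0 \<or> c (s + 3) = 0 \<or>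
      T s = t \<or> T (s + 2) = t \<or> T (s + 3) = t \<or> T (s + 5) = t" for s
    using triple by (metis gr0I le_neq_implies_less)
  \<comment> \<open>A zero at \<open>i\<close> forces weight at least \<open>t\<close> at
    \<open>i + 4\<close> and then, through the windows at \<open>i + 1\<close> and
    \<open>i + 4\<close>, also at \<open>i + 3\<close> and \<open>i + 5\<close>. The windows at
    \<open>i + 2\<close> and \<open>i + 3\<close> can now fail only if \<open>c (i + 2)\<close> and
    \<open>c (i + 6)\<close> both vanish, which contradicts the pair
    \<open>{i + 2, i + 6}\<close>.\<close>
  have pos: "0 < c i" for i
  proof (rule ccontr)
    assume "\<not> 0 < c i"
    then have 0: "c i = 0" by simp
    have pers: "c (i + 8) = 0" "c (i + 9) = c (i + 1)" "c (i + 10) = c (i + 2)"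
        "c (i + 11) = c (i + 3)" "c (i + 12) = c (i + 4)" "c (i + 13) = c (i + 5)"
        "c (i + 14) = c (i + 6)" "c (i + 15) = c (i + 7)"
      using per[of i] per[of "i + 1"] per[of "i + 2"] per[of "i + 3"] per[of "i + 4"]
        per[of "i + 5"] per[of "i + 6"] per[of "i + 7"] 0 by (simp_all add: add.assoc)
    note cov = pair[of i] pair[of "i + 1"] pair[of "i + 2"] pair[of "i + 3"]
      triple[of i] triple[of "i + 1"] triple[of "i + 2"] triple[of "i + 3"]
      triple[of "i + 4"] triple[of "i + 5"] triple[of "i + 6"] triple[of "i + 7"]
    note cov = cov[unfolded T_def, simplified add.assoc, simplified, unfolded pers 0] t
    note n = no[of "i + 1"] no[of "i + 2"] no[of "i + 3"] no[of "i + 4"]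
    note n = n[unfolded T_def, simplified add.assoc, simplified, unfolded pers 0]
    have 4: "t \<le> c (i + 4)" using cov by linarith
    have a: "c (i + 1) = 0 \<or> c (i + 2) = 0 \<or> c (i + 3) = 0"
      using n(1) 4 cov by (elim disjE) linarith+
    have b: "c (i + 5) = 0 \<or> c (i + 6) = 0 \<or> c (i + 7) = 0"
      using n(4) 4 cov by (elim disjE) linarith+
    have 5: "t \<le> c (i + 5)" using a b cov by (elim disjE) linarith+
    have 3: "t \<le> c (i + 3)" using a b cov by (elim disjE) linarith+
    have "c (i + 2) = 0" using n(2) 3 5 4 cov by (elim disjE) linarith+
    moreover have "c (i + 6) = 0" using n(3) 3 5 4 cov by (elim disjE) linarith+
    ultimately show False using cov by linarith
  qed
  obtain a where a: "T a = t" using no[of 0] pos by (metis less_irrefl)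
  have pers: "c (a + 8) = c a" "c (a + 9) = c (a + 1)" "c (a + 10) = c (a + 2)"
      "c (a + 11) = c (a + 3)" "c (a + 12) = c (a + 4)" "c (a + 13) = c (a + 5)"
      "c (a + 14) = c (a + 6)" "c (a + 15) = c (a + 7)"
    using per[of a] per[of "a + 1"] per[of "a + 2"] per[of "a + 3"] per[of "a + 4"]
      per[of "a + 5"] per[of "a + 6"] per[of "a + 7"] by (simp_all add: add.assoc)
  note cov = pair[of a] pair[of "a + 1"] pair[of "a + 2"] pair[of "a + 3"]
    triple[of a] triple[of "a + 1"] triple[of "a + 2"] triple[of "a + 3"]
    triple[of "a + 4"] triple[of "a + 5"] triple[of "a + 6"] triple[of "a + 7"]
  note cov = cov[unfolded T_def, simplified add.assoc, simplified, unfolded pers] t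
    a[unfolded T_def, simplified add.assoc, simplified]
  \<comment> \<open>As \<open>T a = t\<close>, the pair through \<open>a\<close> gives
    \<open>c (a + 4) \<ge> c (a + 3) + c (a + 6)\<close>; the pairs through \<open>a + 3\<close> and
    \<open>a + 6\<close> bound \<open>c (a + 7)\<close> and \<open>c (a + 2)\<close> alike. With all
    weights positive, this is the slack that keeps the four triples of this window from being
    tight.\<close>
  note n = no[of "a + 4"]
  note n = n[unfolded T_def, simplified add.assoc, simplified, unfolded pers]
  show False
    using n cov pos[of a] pos[of "a + 1"] pos[of "a + 2"] pos[of "a + 3"]
      pos[of "a + 4"] pos[of "a + 5"] pos[of "a + 6"] pos[of "a + 7"]
    by (elim disjE) linarith+
qed

text \<open>Induction on \<open>t\<close> over all periodic weights: a peeled window joins the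
  packing and its indicator is subtracted from \<open>c\<close>. The condition
  \<open>(j - s) mod 8 < 4\<close> says that the cyclic window starting at \<open>s\<close> contains
  \<open>j\<close>.\<close>

lemma C8_packing:
  fixes c :: "int \<Rightarrow> nat"
  assumes "\<And>i. c (i + 8) = c i"
    and "\<And>i. t \<le> c i + c (i + 4)" and "\<And>a. t \<le> c a + c (a + 3) + c (a + 6)"
  shows "\<exists>z. (\<Sum>s\<in>{0..<8}. z s) = t \<and>
             (\<forall>j. (\<Sum>s\<in>{s\<in>{0..<8}. (j - s) mod 8 < 4}. z s) \<le> c j)"
  using assms
proof (induction t arbitrary: c)
  case 0
  then show ?case by (intro exI[of _ "\<lambda>_. 0"]) simp
next
  case (Suc t)
  note per = Suc.prems(1)
  have per': "c i = c j" if "i mod 8 = j mod 8" for i j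
    using per that by (rule periodic_mod_eq)
  obtain s0 where s0: "0 < c s0" "0 < c (s0 + 1)" "0 < c (s0 + 2)" "0 < c (s0 + 3)"
      "Suc t < c s0 + c (s0 + 3) + c (s0 + 6)" "Suc t < c (s0 + 2) + c (s0 + 2 + 3) + c (s0 + 2 + 6)"
      "Suc t < c (s0 + 3) + c (s0 + 3 + 3) + c (s0 + 3 + 6)"
      "Suc t < c (s0 + 5) + c (s0 + 5 + 3) + c (s0 + 5 + 6)"
    using C8_peel_window[of c "Suc t"] Suc.prems by auto
  define s where "s = s0 mod 8"
  define \<delta> :: "int \<Rightarrow> nat" where "\<delta> j = (if (j - s) mod 8 < 4 then 1 else 0)" for j
  have \<delta>_add: "\<delta> (a + k) = (if ((a - s) mod 8 + k) mod 8 < 4 then 1 else 0)" for a k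
  proof -
    have "(a + k - s) mod 8 = ((a - s) mod 8 + k) mod 8" by (simp add: mod_simps algebra_simps)
    then show ?thesis by (simp add: \<delta>_def)
  qed
  have mod8: "r = 0 \<or> r = 1 \<or> r = 2 \<or> r = 3 \<or> r = 4 \<or> r = 5 \<or> r = 6 \<or> r = 7"
    if "r = i mod 8" for r i :: int
    using that pos_mod_bound[of 8 i] pos_mod_sign[of 8 i] by linarith
  define c' where "c' j = c j - \<delta> j" for j
  have "\<delta> j \<le> c j" for j
  proof (cases "(j - s) mod 8 < 4")
    case True
    define r where "r = (j - s) mod 8"
    have r: "r = 0 \<or> r = 1 \<or> r = 2 \<or> r = 3" using True by (auto simp: r_def)
    have "c j = c (s0 + r)" by (rule per') (simp add: r_def s_def mod_simps)
    then show ?thesis using r s0 by (auto simp: \<delta>_def)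
  qed (simp add: \<delta>_def)
  then have c: "c j = c' j + \<delta> j" for j by (simp add: c'_def)
  have "c' (i + 8) = c' i" for i
  proof -
    have "(i + 8 - s) mod 8 = (i - s) mod 8" using mod_add_self2[of "i - s" 8] by (simp add: algebra_simps)
    then show ?thesis using per by (simp add: c'_def \<delta>_def)
  qed
  moreover have "t \<le> c' i + c' (i + 4)" for i
  proof -
    have "\<delta> i + \<delta> (i + 4) = 1"
      using mod8[OF refl, of "i - s"] \<delta>_add[of i 0] \<delta>_add[of i 4] by (elim disjE) simp_all
    then show ?thesis using Suc.prems(2)[of i] c[of i] c[of "i+4"] by linarith
  qed
  moreover have "t \<le> c' a + c' (a + 3) + c' (a + 6)" for a
  proof -
    define r where "r = (a - s) mod 8"
    have eq: "c (a + k) = c (s0 + r + k)" for k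
      using mod_add_right_eq[of "s0 + k" "a - s0" 8]
      by (intro per') (simp add: r_def s_def mod_simps algebra_simps)
    show ?thesis
    \<comment> \<open>For these residues the triple loses two units, and the strict inequality from
      the peeling step pays for the second; for all others it loses at most one.\<close>
    proof (cases "r = 0 \<or> r = 2 \<or> r = 3 \<or> r = 5")
      case True
      then have "Suc t < c a + c (a + 3) + c (a + 6)" using s0(5-8) eq[of 0] eq[of 3] eq[of 6] by auto
      moreover have "\<delta> a + \<delta> (a + 3) + \<delta> (a + 6) \<le> 2"
        using True \<delta>_add[of a 0] \<delta>_add[of a 3] \<delta>_add[of a 6] by (auto simp flip: r_def)
      ultimately show ?thesis using c[of a] c[of "a+3"] c[of "a+6"] by linarith
    next
      case False
      then have "\<delta> a + \<delta> (a + 3) + \<delta> (a + 6) \<le> 1"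
        using mod8[OF r_def] \<delta>_add[of a 0] \<delta>_add[of a 3] \<delta>_add[of a 6]
        by (elim disjE) (simp_all flip: r_def)
      then show ?thesis using c[of a] c[of "a+3"] c[of "a+6"] Suc.prems(3)[of a] by linarith
    qed
  qed
  ultimately obtain z where z: "(\<Sum>s\<in>{0..<8}. z s) = t"
      "\<And>j. (\<Sum>s\<in>{s\<in>{0..<8}. (j - s) mod 8 < 4}. z s) \<le> c' j"
    using Suc.IH[of c'] by blast
  have s: "s \<in> {0..<8}" by (simp add: s_def)
  have sum_z: "(\<Sum>i\<in>A. (z(s := Suc (z s))) i) = (\<Sum>i\<in>A. z i) + (if s \<in> A then 1 else 0)"
    if "finite A" for A
    using that by (induction A rule: finite_induct) auto
  show ?case
  proof (intro exI[of _ "z(s := Suc (z s))"] conjI allI)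
    show "(\<Sum>i\<in>{0..<8}. (z(s := Suc (z s))) i) = Suc t" using z(1) s by (simp add: sum_z del: fun_upd_apply)
    fix j
    have "(\<Sum>i\<in>{i\<in>{0..<8}. (j - i) mod 8 < 4}. (z(s := Suc (z s))) i)
        = (\<Sum>i\<in>{i\<in>{0..<8}. (j - i) mod 8 < 4}. z i) + \<delta> j"
      using s by (subst sum_z) (auto simp: \<delta>_def intro: finite_subset[of _ "{0..<8}"])
    then show "(\<Sum>i\<in>{i\<in>{0..<8}. (j - i) mod 8 < 4}. (z(s := Suc (z s))) i) \<le> c j"
      using z(2)[of j] c[of j] by linarith
  qed
qed

text \<open>With \<open>t\<close> the least weight of the listed covers, the hypotheses of
  \<open>C8_packing\<close> hold, and a minimiser \<open>X\<close> is itself a cover of cost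
  \<open>t\<close>.\<close>

lemma mengerian_C8_windows:
  fixes v :: "int \<Rightarrow> 'a"
  assumes inj: "\<And>i j. v i = v j \<longleftrightarrow> i mod 8 = j mod 8"
  shows "mengerian (range v) (range (\<lambda>s. v ` {s..s + 3}))" (is "mengerian ?V ?F")
proof (rule mengerianI)
  fix c :: "'a \<Rightarrow> nat"
  have V: "?V = v ` {0..<8}"
  proof -
    have "v i = v (i mod 8)" for i using inj by simp
    then show ?thesis by (auto intro!: image_eqI[of _ _ "_ mod 8"])
  qed
  have fV: "finite ?V" by (simp add: V)
  have fF: "finite ?F" using fV by (auto intro: finite_subset[of _ "Pow ?V"])
  have mem: "v j \<in> v ` {s..s + 3} \<longleftrightarrow> (j - s) mod 8 < 4" for j s
  proof
    assume "v j \<in> v ` {s..s + 3}"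
    then obtain i where i: "s \<le> i" "i \<le> s + 3" "j mod 8 = i mod 8" using inj by auto
    have "(j - s) mod 8 = (i - s) mod 8" using i(3) by (metis mod_diff_left_eq)
    also have "\<dots> = i - s" using i by simp
    finally show "(j - s) mod 8 < 4" using i by simp
  next
    assume "(j - s) mod 8 < 4"
    moreover have "v j = v (s + (j - s) mod 8)" using inj by (simp add: mod_simps)
    ultimately show "v j \<in> v ` {s..s + 3}" by (intro image_eqI[of _ _ "s + (j - s) mod 8"]) auto
  qed
  define d where "d i = c (v i)" for i
  have per: "d (i + 8) = d i" for i using inj[of "i + 8" i] by (simp add: d_def)
  have dmod: "d (i mod 8 + k) = d (i + k)" for i k
    unfolding d_def using inj by (metis mod_add_left_eq)
  \<comment> \<open>The covers are written with integer representatives of the residues, so each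
    pair is listed twice. Representatives within one cover differ by less than 8, which makes
    \<open>v\<close> injective on it.\<close>
  define CC where "CC = (\<lambda>i. {i, i + 4 :: int}) ` {0..<8} \<union> (\<lambda>i. {i, i + 3, i + 6}) ` {0..<8}"
  have CC: "finite CC" "CC \<noteq> {}" by (auto simp: CC_def)
  define t where "t = Min (sum d ` CC)"
  have "t \<in> sum d ` CC" unfolding t_def using CC by (intro Min_in) auto
  then obtain X where X: "X \<in> CC" "t = sum d X" by blast
  have t_le: "t \<le> sum d Y" if "Y \<in> CC" for Y
    unfolding t_def using that CC by (intro Min_le) auto
  have pair: "t \<le> d i + d (i + 4)" for i
    using t_le[of "{i mod 8, i mod 8 + 4}"] dmod[of i 0] dmod[of i 4] by (simp add: CC_def)
  have triple: "t \<le> d a + d (a + 3) + d (a + 6)" for a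
    using t_le[of "{a mod 8, a mod 8 + 3, a mod 8 + 6}"] dmod[of a 0] dmod[of a 3] dmod[of a 6]
    by (simp add: CC_def)
  obtain z where z: "(\<Sum>s\<in>{0..<8}. z s) = t"
      "\<And>j. (\<Sum>s\<in>{s\<in>{0..<8}. (j - s) mod 8 < 4}. z s) \<le> d j"
    using C8_packing[OF per pair triple] by blast
  have "\<exists>y. integral_packing ?V ?F c y \<and> (\<Sum>e\<in>?F. y e) = (\<Sum>s\<in>{0..<8}. z s)"
    by (rule indexed_packing[OF fF, where E = "\<lambda>s. v ` {s..s + 3}"]) (use z(2) in \<open>auto simp: mem d_def\<close>)
  then obtain y where y: "integral_packing ?V ?F c y" "(\<Sum>e\<in>?F. y e) = t" using z(1) by auto
  have "integral_cover ?V ?F (\<lambda>u. if u \<in> v ` X then 1 else 0)"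
  proof (rule integral_cover_indicator[OF fV])
    fix e assume "e \<in> ?F"
    then obtain s where e: "e = v ` {s..s + 3}" by blast
    have "\<exists>x\<in>X. (x - s) mod 8 < 4"
    proof -
      obtain i where i: "X = {i, i + 4} \<or> X = {i, i + 3, i + 6}" using X(1) by (auto simp: CC_def)
      define r where "r = (i - s) mod 8"
      have r: "r = 0 \<or> r = 1 \<or> r = 2 \<or> r = 3 \<or> r = 4 \<or> r = 5 \<or> r = 6 \<or> r = 7"
        using pos_mod_bound[of 8 "i - s"] pos_mod_sign[of 8 "i - s"] unfolding r_def by linarith
      have "(i + k - s) mod 8 = (r + k) mod 8" for k by (simp add: r_def mod_simps algebra_simps)
      from this[of 0] this[of 3] this[of 4] this[of 6] show ?thesis
        using i r by (elim disjE) simp_all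
    qed
    then show "\<exists>u\<in>e. u \<in> ?V \<and> u \<in> v ` X" using e mem by blast
  qed
  moreover have "(\<Sum>u\<in>?V. c u * (if u \<in> v ` X then 1 else 0)) = t"
  proof -
    have "inj_on v X"
    proof (rule inj_onI)
      fix x y assume xy: "x \<in> X" "y \<in> X" "v x = v y"
      then have "8 dvd x - y" using inj by (simp add: mod_eq_dvd_iff)
      moreover have "\<bar>x - y\<bar> < 8" using xy X(1) by (auto simp: CC_def)
      ultimately show "x = y" using zdvd_not_zless[of "\<bar>x - y\<bar>" 8] by auto
    qed
    have "(\<Sum>u\<in>?V. c u * (if u \<in> v ` X then 1 else 0)) = (\<Sum>u\<in>v ` X. c u)"
      using fV by (intro sum.mono_neutral_cong_right) auto
    also have "\<dots> = sum d X" using \<open>inj_on v X\<close> by (simp add: sum.reindex d_def)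
    finally show ?thesis using X(2) by simp
  qed
  ultimately show "\<exists>x y. integral_cover ?V ?F x \<and> integral_packing ?V ?F c y \<and>
      (\<Sum>v\<in>?V. c v * x v) \<le> (\<Sum>e\<in>?F. y e)"
    using y(1) by (intro exI conjI) (assumption, assumption, simp add: y(2))
qed

subsection \<open>A parity obstruction\<close>

lemma sum_rotate_mod:
  fixes f :: "nat \<Rightarrow> 'b::comm_monoid_add"
  shows "(\<Sum>i<N. f ((i + t) mod N)) = (\<Sum>i<N. f i)"
proof -
  have "inj_on (\<lambda>i. (i + t) mod N) {..<N}"
  proof (rule inj_onI)
    fix i j assume ij: "i \<in> {..<N}" "j \<in> {..<N}" "(i + t) mod N = (j + t) mod N"
    have "int N dvd (int i + int t) - (int j + int t)"
      using ij(3) by (metis mod_eq_dvd_iff of_nat_add of_nat_mod)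
    then have "int i mod int N = int j mod int N" by (simp add: mod_eq_dvd_iff)
    then show "i = j" using ij(1,2) by simp
  qed
  moreover have "(\<lambda>i. (i + t) mod N) ` {..<N} \<subseteq> {..<N}" by (cases N) auto
  ultimately have "bij_betw (\<lambda>i. (i + t) mod N) {..<N} {..<N}"
    using endo_inj_surj[OF finite_lessThan] by (auto simp only: bij_betw_def)
  then show ?thesis by (rule sum.reindex_bij_betw)
qed

text \<open>Give the vertices \<open>u i\<close> weight 1 and those of \<open>D\<close> a prohibitive weight. Every edge of a packing
  uses at least \<open>k\<close> of the \<open>N\<close> unit weights, and averaging a cover over the \<open>E i\<close> gives a cost of at
  least \<open>N / k\<close>; equality of both values would force \<open>k dvd N\<close>.\<close>

lemma not_mengerian_cyclic:
  fixes u :: "nat \<Rightarrow> 'a"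
  assumes "finite V" "F \<subseteq> Pow V" "u ` {..<N} \<union> D \<subseteq> V" "D \<inter> u ` {..<N} = {}"
    and inj: "inj_on u {..<N}" and "k > 0" "\<not> k dvd N"
    and E: "\<And>i. i < N \<Longrightarrow> E i \<in> F" "\<And>i. i < N \<Longrightarrow> E i \<subseteq> u ` {..<N} \<union> D"
      "\<And>i. i < N \<Longrightarrow> E i \<inter> u ` {..<N} \<subseteq> (\<lambda>t. u ((i + t) mod N)) ` {..<k}"
    and F: "\<And>e. e \<in> F \<Longrightarrow> e \<subseteq> u ` {..<N} \<union> D \<Longrightarrow> k \<le> card (e \<inter> u ` {..<N})"
  shows "\<not> mengerian V F"
proof
  assume "mengerian V F"
  define U where "U = u ` {..<N}"
  have N: "N > 0" using assms(7) by (cases N) auto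
  have cU: "card U = N" unfolding U_def using inj by (simp add: card_image)
  have U: "U \<subseteq> V" "finite U" using assms(3) by (auto simp: U_def)
  \<comment> \<open>The packing value is at most the total unit weight \<open>N\<close>, so
    \<open>Suc N\<close> is already more than an optimal cover can spend on a single vertex.\<close>
  define c where "c w = (if w \<in> U then 1 else if w \<in> D then Suc N else 0)" for w
  obtain x y where x: "integral_cover V F x" and y: "integral_packing V F c y"
    and eq: "(\<Sum>w\<in>V. c w * x w) = (\<Sum>e\<in>F. y e)"
    using mengerianD[OF \<open>mengerian V F\<close>, of c] by blast
  define T where "T = (\<Sum>e\<in>F. y e)"
  have fF: "finite F" using assms(1,2) by (auto intro: finite_subset)
  have zero: "y e = 0" if e: "e \<in> F" "\<not> e \<subseteq> U \<union> D" for e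
  proof -
    obtain w where w: "w \<in> e" "w \<notin> U" "w \<notin> D" using e(2) by blast
    have "y e * incidence e w \<le> (\<Sum>e\<in>F. y e * incidence e w)"
      using e fF by (intro member_le_sum) auto
    also have "\<dots> \<le> c w" using y w e(1) assms(2) by (auto simp: integral_packing_def)
    finally show ?thesis using w by (simp add: c_def incidence_def)
  qed
  have "k * T = (\<Sum>e\<in>F. y e * k)" by (simp add: T_def sum_distrib_left mult.commute)
  also have "\<dots> \<le> (\<Sum>e\<in>F. y e * card (e \<inter> U))"
    using F zero by (intro sum_mono) (fastforce simp: U_def)
  also have "\<dots> = (\<Sum>e\<in>F. \<Sum>w\<in>U. y e * incidence e w)"
  proof (rule sum.cong[OF refl])
    fix e
    have "card (e \<inter> U) = (\<Sum>w\<in>e \<inter> U. 1)" by simp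
    also have "\<dots> = (\<Sum>w\<in>U. incidence e w)"
      using U(2) by (intro sum.mono_neutral_cong_left) (auto simp: incidence_def)
    finally show "y e * card (e \<inter> U) = (\<Sum>w\<in>U. y e * incidence e w)"
      by (simp add: sum_distrib_left)
  qed
  also have "\<dots> = (\<Sum>w\<in>U. \<Sum>e\<in>F. y e * incidence e w)" by (rule sum.swap)
  also have "\<dots> \<le> (\<Sum>w\<in>U. c w)"
    using y U(1) by (intro sum_mono) (auto simp: integral_packing_def)
  also have "\<dots> = N" by (simp add: c_def cU)
  finally have upper: "k * T \<le> N" .
  then have "T \<le> N" using assms(6) by (metis One_nat_def Suc_leI mult_le_mono1 mult_1 order_trans)
  have xD: "x w = 0" if w: "w \<in> D" for w
  proof -
    have "c w * x w \<le> (\<Sum>w\<in>V. c w * x w)"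
      using w assms(1,3) by (intro member_le_sum) auto
    then have "c w * x w \<le> N" using eq \<open>T \<le> N\<close> by (simp add: T_def)
    moreover have "c w = Suc N" using w assms(4) by (auto simp: c_def U_def)
    ultimately show ?thesis by (cases "x w") auto
  qed
  have "1 \<le> (\<Sum>t<k. x (u ((i + t) mod N)))" if i: "i < N" for i
  proof -
    have "1 \<le> (\<Sum>w\<in>V. incidence (E i) w * x w)"
      using x E(1)[OF i] by (auto simp: integral_cover_def)
    also have "\<dots> = (\<Sum>w\<in>E i \<inter> U. x w)"
    proof (rule sum.mono_neutral_cong_right[OF assms(1)])
      show "E i \<inter> U \<subseteq> V" using U by blast
      show "\<forall>w\<in>V - E i \<inter> U. incidence (E i) w * x w = 0"
        using E(2)[OF i] xD by (auto simp: incidence_def U_def)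
    qed (auto simp: incidence_def)
    also have "\<dots> \<le> (\<Sum>w\<in>(\<lambda>t. u ((i + t) mod N)) ` {..<k}. x w)"
      using E(3)[OF i] by (intro sum_mono2) (auto simp: U_def)
    also have "\<dots> \<le> (\<Sum>t<k. x (u ((i + t) mod N)))"
      using sum_image_le[of "{..<k}" x "\<lambda>t. u ((i + t) mod N)"] by (simp add: o_def)
    finally show ?thesis .
  qed
  then have "(\<Sum>i<N. 1) \<le> (\<Sum>i<N. \<Sum>t<k. x (u ((i + t) mod N)))" by (intro sum_mono) auto
  also have "\<dots> = (\<Sum>t<k. \<Sum>i<N. x (u ((i + t) mod N)))" by (rule sum.swap)
  \<comment> \<open>For each offset \<open>t\<close> the position \<open>i + t\<close> runs once
    around the cycle, so every \<open>u i\<close> is counted \<open>k\<close> times.\<close>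
  also have "\<dots> = k * (\<Sum>i<N. x (u i))" using sum_rotate_mod[of "\<lambda>i. x (u i)"] by simp
  also have "(\<Sum>i<N. x (u i)) = (\<Sum>w\<in>U. c w * x w)"
    unfolding U_def using inj by (simp add: sum.reindex c_def U_def)
  also have "k * \<dots> \<le> k * T" unfolding T_def eq[symmetric]
    using U assms(1) by (intro mult_le_mono2 sum_mono2) auto
  finally have "k * T = N" using upper by simp
  then show False using assms(7) by auto
qed

subsection \<open>Paths and circuits in simple graphs\<close>

context pair_graph
begin

abbreviation adj :: "'a \<Rightarrow> 'a \<Rightarrow> bool" where
  "adj u v \<equiv> (u, v) \<in> parcs G"

lemma adj_sym: "adj u v \<Longrightarrow> adj v u"
  using pair_sym_arcs by (auto simp: symmetric_def elim: symE)

lemma adj_irrefl [simp]: "\<not> adj u u"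
  using pair_no_loops[of "(u, u)"] by auto

lemma adj_in_verts: "adj u v \<Longrightarrow> u \<in> pverts G" "adj u v \<Longrightarrow> v \<in> pverts G"
  by (rule in_arcsD1 in_arcsD2, assumption)+

lemma H3_I:
  assumes "adj a b" "adj b c" "adj c d" "distinct [a, b, c, d]"
  shows "{a, b, c, d} \<in> H3 G"
proof -
  have "vpath [a, b, c, d] (with_proj G)"
    using assms adj_in_verts by (auto simp: vpath_def vwalk_def)
  moreover have "card {a, b, c, d} = 4" using assms(4) by simp
  ultimately show ?thesis
    using assms adj_in_verts unfolding H3_def by (auto intro!: exI[of _ "[a, b, c, d]"])
qed

lemma H3_E:
  assumes "e \<in> H3 G"
  obtains a b c d where "e = {a, b, c, d}" "adj a b" "adj b c" "adj c d" "distinct [a, b, c, d]"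
proof -
  obtain p where p: "vpath p (with_proj G)" "vwalk_length p = 3" "set p \<subseteq> e" and e: "card e = 4"
    using assms by (auto simp: H3_def)
  have "length p = 4" using p(2) by simp
  then obtain a b c d where abcd: "p = [a, b, c, d]"
    by (auto simp: eval_nat_numeral length_Suc_conv)
  have d: "distinct [a, b, c, d]" using p(1) abcd by (simp add: vpath_def)
  then have "card (set p) = 4" using abcd by simp
  then have "e = {a, b, c, d}"
    using p(3) e abcd by (metis card_subset_eq card.infinite list.set(1) list.simps(15) zero_neq_numeral)
  then show thesis using p(1) d abcd by (intro that) (auto simp: vpath_def vwalk_def)
qed

lemma H3_subset: "H3 G \<subseteq> Pow (pverts G)" and H3_card: "e \<in> H3 G \<Longrightarrow> card e = 4"
  by (auto simp: H3_def)

lemma connected_closed: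
  assumes "Digraph_Component.connected (with_proj G)"
    and "a \<in> A" "A \<subseteq> pverts G" and closed: "\<And>u v. u \<in> A \<Longrightarrow> adj u v \<Longrightarrow> v \<in> A"
  shows "A = pverts G"
proof -
  have sc: "strongly_connected (with_proj G)"
    using symmetric_connected_imp_strongly_connected[OF _ assms(1)] pair_sym_arcs by simp
  have "v \<in> A" if "v \<in> pverts G" for v
  proof -
    have "a \<rightarrow>\<^sup>*\<^bsub>with_proj G\<^esub> v" using sc that assms(2,3) by (auto simp: strongly_connected_def)
    then show ?thesis
      by (induction rule: reachable_induct) (use assms(2) closed in auto)
  qed
  then show ?thesis using assms(3) by blast
qed

lemma connected_exit:
  assumes "Digraph_Component.connected (with_proj G)"
    and "A \<subset> pverts G" "A \<noteq> {}"
  obtains u v where "u \<in> A" "v \<in> pverts G - A" "adj u v"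
proof -
  obtain a where "a \<in> A" using assms(3) by blast
  then have "\<not> (\<forall>u v. u \<in> A \<longrightarrow> adj u v \<longrightarrow> v \<in> A)"
    using connected_closed[OF assms(1) \<open>a \<in> A\<close>] assms(2) by blast
  then show thesis using that adj_in_verts by blast
qed

text \<open>The start vertex is not repeated at the end, so the length of the list is the number of
  edges. Vertex lists replace the arc walks behind \<open>cycle\<close>.\<close>

definition circuit :: "'a list \<Rightarrow> bool" where
  "circuit p \<longleftrightarrow> 3 \<le> length p \<and> distinct p \<and> successively adj p \<and> adj (last p) (hd p)"

lemma awalk_vwalk_arcs:
  assumes "successively adj (a # p)" "a \<in> pverts G"
  shows "awalk a (vwalk_arcs (a # p)) (last (a # p)) \<and> pawalk_verts a (vwalk_arcs (a # p)) = a # p"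
  using assms
proof (induction p arbitrary: a)
  case Nil
  then show ?case by (simp add: awalk_def)
next
  case (Cons b p)
  then have "adj a b" by simp
  then show ?case using Cons.IH[of b] Cons.prems adj_in_verts(2)[of a b] by (auto simp: awalk_def)
qed

lemma successively_pawalk_verts:
  assumes "awalk u q w"
  shows "successively adj (pawalk_verts u q) \<and> hd (pawalk_verts u q) = u \<and> last (pawalk_verts u q) = w"
  using assms
proof (induction q arbitrary: u)
  case Nil
  then show ?case by (simp add: awalk_def)
next
  case (Cons e q)
  have "adj (fst e) (snd e)" "fst e = u" "awalk (snd e) q w"
    using Cons.prems adj_in_verts by (auto simp: awalk_def)
  then show ?case using Cons.IH[of "snd e"]
    by (auto simp: successively_Cons awalk_verts_ne_eq)
qed

lemma cycle_iff_circuit: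
  "(\<exists>q. cycle q \<and> 3 \<le> length q) \<longleftrightarrow> (\<exists>p. circuit p)"
proof
  assume "\<exists>q. cycle q \<and> 3 \<le> length q"
  then obtain q u where q: "3 \<le> length q" "awalk u q u" "distinct (tl (pawalk_verts u q))"
    by (auto simp: cycle_def)
  define w where "w = pawalk_verts u q"
  have w: "successively adj w" "hd w = u" "last w = u" "length w = Suc (length q)"
    using successively_pawalk_verts[OF q(2)] length_awalk_verts[of u q] by (simp_all add: w_def)
  obtain p where p: "w = u # p" using w by (cases w) auto
  have ne: "p \<noteq> []" using w(4) q(1) p by auto
  then have "circuit p" using w p q by (auto simp: circuit_def w_def[symmetric] successively_Cons)
  then show "\<exists>p. circuit p" by blast
next
  assume "\<exists>p. circuit p"
  then obtain p where p: "circuit p" by blast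
  then obtain a r where pr: "p = a # r" by (cases p) (auto simp: circuit_def)
  moreover have "r \<noteq> []" using p pr by (auto simp: circuit_def)
  ultimately have r: "p = a # r" "r \<noteq> []" by auto
  have s: "successively adj (a # (r @ [a]))"
    using p r by (auto simp: circuit_def successively_append_iff successively_Cons)
  have "a \<in> pverts G" using p r adj_in_verts by (auto simp: circuit_def)
  note aw = awalk_vwalk_arcs[OF s this]
  have len: "length (vwalk_arcs (a # r @ [a])) = length p"
    unfolding vwalk_length_def[symmetric] vwalk_length_simp using r by simp
  have "cycle (vwalk_arcs (a # r @ [a]))"
    unfolding cycle_def using aw len p r by (intro exI[of _ a]) (auto simp: circuit_def)
  then show "\<exists>q. cycle q \<and> 3 \<le> length q" using len p by (auto simp: circuit_def intro!: exI[of _ "vwalk_arcs (a # r @ [a])"])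
qed

text \<open>A chord closes up the segment of the path between its ends; the index gap of 2 gives
  that segment at least three vertices.\<close>

lemma circuit_sublist:
  assumes "distinct p" "successively adj p" "i + 2 \<le> j" "j < length p" "adj (p ! i) (p ! j)"
  shows "circuit (take (Suc j - i) (drop i p))" (is "circuit ?q")
proof -
  have len: "length ?q = Suc j - i" using assms by simp
  have "?q ! 0 = p ! i" "?q ! (j - i) = p ! j" using assms by auto
  then have "hd ?q = p ! i" "last ?q = p ! j" using assms len
    by (simp_all add: hd_conv_nth last_conv_nth del: nth_take nth_drop)
  moreover have "successively adj ?q"
    using assms by (auto simp: successively_conv_nth)
  ultimately show ?thesis using assms adj_sym by (auto simp: circuit_def)
qed

text \<open>Any other adjacency would cut off a shorter circuit. The edge between the first and the
  last vertex is exempt because the segment it closes is all of \<open>p\<close>.\<close>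

lemma shortest_circuit_chordless:
  assumes "circuit p" "\<And>q. circuit q \<Longrightarrow> length p \<le> length q"
    and "i < j" "j < length p" "adj (p ! i) (p ! j)"
  shows "j = Suc i \<or> (i = 0 \<and> j = length p - 1)"
proof (rule ccontr)
  assume *: "\<not> ?thesis"
  then have "circuit (take (Suc j - i) (drop i p))"
    using assms by (intro circuit_sublist) (auto simp: circuit_def)
  then have "length p \<le> length (take (Suc j - i) (drop i p))" by (rule assms(2))
  then show False using assms(3,4) * by auto
qed

text \<open>Take a repeated vertex at the smallest distance \<open>d\<close> along the walk. The
  \<open>d\<close> vertices of that stretch are distinct and form a circuit, since
  \<open>d = 1\<close> would be a loop and \<open>d = 2\<close> a reversal.\<close>

lemma nonbacktracking_distinct:
  assumes "\<nexists>p. circuit p" "successively adj w"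
    and nb: "\<And>i. Suc (Suc i) < length w \<Longrightarrow> w ! i \<noteq> w ! Suc (Suc i)"
  shows "distinct w"
proof (rule ccontr)
  assume "\<not> distinct w"
  then have "\<exists>d i. 0 < d \<and> i + d < length w \<and> w ! i = w ! (i + d)"
    by (auto simp: distinct_conv_nth) (metis add_diff_inverse_nat nat_neq_iff not_less_iff_gr_or_eq zero_less_diff)
  then obtain d where d: "\<exists>i. 0 < d \<and> i + d < length w \<and> w ! i = w ! (i + d)"
    and min: "\<And>d'. \<exists>i. 0 < d' \<and> i + d' < length w \<and> w ! i = w ! (i + d') \<Longrightarrow> d \<le> d'"
    using exists_least_iff[of "\<lambda>d. \<exists>i. 0 < d \<and> i + d < length w \<and> w ! i = w ! (i + d)"]
    by (metis not_le)
  then obtain i where i: "0 < d" "i + d < length w" "w ! i = w ! (i + d)" by blast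
  let ?q = "take d (drop i w)"
  have adjw: "adj (w ! k) (w ! Suc k)" if "Suc k < length w" for k
    using assms(2) that by (auto simp: successively_conv_nth)
  have "d \<noteq> 1" using adjw[of i] i by auto
  moreover have "d \<noteq> 2" using nb[of i] i by auto
  ultimately have d3: "3 \<le> d" using i by linarith
  have len: "length ?q = d" using i by simp
  have "distinct ?q"
  proof (rule ccontr)
    assume "\<not> distinct ?q"
    then obtain a b where ab: "a < b" "b < d" "w ! (i + a) = w ! (i + b)"
      using len i by (auto simp: distinct_conv_nth) (metis nat_neq_iff)
    then have "d \<le> b - a" using i by (intro min exI[of _ "i + a"]) auto
    then show False using ab by linarith
  qed
  moreover have "successively adj ?q" using assms(2) i by (auto simp: successively_conv_nth)
  moreover have "hd ?q = w ! (i + d)" "last ?q = w ! (i + (d - 1))"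
    using i len d3 by (simp_all add: hd_conv_nth last_conv_nth)
  moreover have "adj (w ! (i + (d - 1))) (w ! (i + d))" using adjw[of "i + (d - 1)"] i d3 by simp
  ultimately have "circuit ?q" using len d3 by (simp add: circuit_def)
  then show False using assms(1) by blast
qed

subsection \<open>Small forbidden configurations\<close>

text \<open>This is the cyclic obstruction with \<open>N = 3\<close> and \<open>k = 2\<close>. After
  contraction of \<open>D\<close> the sets \<open>A\<close>, \<open>B\<close>, \<open>C\<close>
  become the sides of a triangle, where packings have value at most 1 and covers cost at least
  2.\<close>

lemma not_mengerian_triangle_minor:
  assumes "distinct [x, y, z]" "{x, y, z} \<inter> D = {}" "D \<subseteq> pverts G"
    and "A \<in> H3 G" "A \<inter> {x, y, z} = {x, y}" "A \<subseteq> {x, y, z} \<union> D"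
    and "B \<in> H3 G" "B \<inter> {x, y, z} = {y, z}" "B \<subseteq> {x, y, z} \<union> D"
    and "C \<in> H3 G" "C \<inter> {x, y, z} = {x, z}" "C \<subseteq> {x, y, z} \<union> D"
    and two: "\<And>e. e \<in> H3 G \<Longrightarrow> e \<subseteq> {x, y, z} \<union> D \<Longrightarrow> 2 \<le> card (e \<inter> {x, y, z})"
  shows "\<not> mengerian (pverts G) (H3 G)"
proof -
  define u where "u i = [x, y, z] ! i" for i
  define E where "E i = [A, B, C] ! i" for i
  have u: "u 0 = x" "u (Suc 0) = y" "u 2 = z" by (auto simp: u_def)
  have E: "E 0 = A" "E (Suc 0) = B" "E 2 = C" by (auto simp: E_def)
  have l3: "{..<3::nat} = {0, Suc 0, 2}" and l2: "{..<2::nat} = {0, Suc 0}" by auto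
  have U: "u ` {..<3} = {x, y, z}" by (simp add: l3 u insert_commute)
  show ?thesis
  proof (rule not_mengerian_cyclic[where u = u and N = 3 and k = 2 and D = D and E = E])
    have "A \<subseteq> pverts G" "B \<subseteq> pverts G" using assms(4,7) H3_subset by auto
    moreover have "x \<in> A" "y \<in> A" "z \<in> B" using assms(5,8) by blast+
    ultimately show "u ` {..<3} \<union> D \<subseteq> pverts G" unfolding U using assms(3) by auto
    show "inj_on u {..<3}" using assms(1) by (auto simp: l3 u)
    fix i :: nat assume "i < 3"
    then have i: "i = 0 \<or> i = Suc 0 \<or> i = 2" by auto
    show "E i \<in> H3 G" "E i \<subseteq> u ` {..<3} \<union> D" using i assms by (auto simp: E U)
    show "E i \<inter> u ` {..<3} \<subseteq> (\<lambda>t. u ((i + t) mod 3)) ` {..<2}"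
      using i unfolding U l2 by (elim disjE) (simp_all add: E u assms(5,8,11) numeral_2_eq_2[symmetric])
  qed (use assms(2) two H3_subset pair_finite_verts in \<open>auto simp: U\<close>)
qed

text \<open>Contract \<open>a\<close> and \<open>b\<close>: a four-element subset of the five
  vertices always keeps two of \<open>x\<close>, \<open>y\<close>, \<open>z\<close>.\<close>

lemma not_mengerian_five_set:
  assumes W: "distinct [x, y, z, a, b]"
    and "{x, y, a, b} \<in> H3 G" "{y, z, a, b} \<in> H3 G" "{x, z, a, b} \<in> H3 G"
  shows "\<not> mengerian (pverts G) (H3 G)"
proof (rule not_mengerian_triangle_minor[of x y z "{a, b}" "{x, y, a, b}" "{y, z, a, b}" "{x, z, a, b}"])
  fix e assume e: "e \<in> H3 G" "e \<subseteq> {x, y, z} \<union> {a, b}"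
  have "card e \<le> card (e \<inter> {x, y, z}) + card (e \<inter> {a, b})"
    using e(2) by (metis Int_Un_distrib card_Un_le inf.absorb_iff1)
  moreover have "card (e \<inter> {a, b}) \<le> card {a, b}" by (intro card_mono) auto
  moreover have "card {a, b} \<le> 2" by (simp add: card_insert_if)
  ultimately show "2 \<le> card (e \<inter> {x, y, z})" using H3_card[OF e(1)] by linarith
qed (use assms H3_subset in auto)

text \<open>The path \<open>x' x w y y'\<close> with \<open>z\<close> attached to \<open>w\<close>; contracting \<open>w\<close>, \<open>x'\<close>, \<open>y'\<close> leaves a triangle, because a
  path on four vertices does not contain three independent ones.\<close>

lemma not_mengerian_spider:
  assumes dist: "distinct [x', x, w, y, y', z]"
    and "adj x' x" "adj x w" "adj w y" "adj y y'" "adj w z"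
    and indep: "\<not> adj w x'" "\<not> adj w y'" "\<not> adj x' y'"
  shows "\<not> mengerian (pverts G) (H3 G)"
proof (rule not_mengerian_triangle_minor[of x y z "{w, x', y'}" "{x', x, w, y}" "{z, w, y, y'}" "{x', x, w, z}"])
  note sym = assms(2-6)[THEN adj_sym]
  show "{x', x, w, y} \<in> H3 G" "{z, w, y, y'} \<in> H3 G" "{x', x, w, z} \<in> H3 G"
    using assms sym by (intro H3_I; auto)+
  fix e assume e: "e \<in> H3 G" "e \<subseteq> {x, y, z} \<union> {w, x', y'}"
  let ?I = "{w, x', y'}"
  have "\<not> ?I \<subseteq> e"
  proof
    assume I: "?I \<subseteq> e"
    obtain a b c d where p: "e = {a, b, c, d}" "adj a b" "adj b c" "adj c d" "distinct [a, b, c, d]"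
      using H3_E[OF e(1)] .
    have nI: "\<not> (s \<in> ?I \<and> t \<in> ?I)" if "adj s t" for s t
      using that indep adj_sym by auto
    have "?I \<subseteq> ({a, b} \<inter> ?I) \<union> ({c, d} \<inter> ?I)" using I p(1) by blast
    then have "card ?I \<le> card (({a, b} \<inter> ?I) \<union> ({c, d} \<inter> ?I))" by (rule card_mono[rotated]) simp
    also have "\<dots> \<le> card ({a, b} \<inter> ?I) + card ({c, d} \<inter> ?I)" by (rule card_Un_le)
    finally have "card ?I \<le> card ({a, b} \<inter> ?I) + card ({c, d} \<inter> ?I)" .
    moreover have "card ({a, b} \<inter> ?I) \<le> 1" using nI[OF p(2)] by (auto simp: card_insert_if Int_insert_left)
    moreover have "card ({c, d} \<inter> ?I) \<le> 1" using nI[OF p(4)] by (auto simp: card_insert_if Int_insert_left)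
    moreover have "card ?I = 3" using dist by auto
    ultimately show False by linarith
  qed
  then have "e \<inter> ?I \<subset> ?I" by blast
  then have "card (e \<inter> ?I) < card ?I" by (intro psubset_card_mono) auto
  moreover have "card ?I \<le> 3" by (simp add: card_insert_if)
  moreover have "card e \<le> card (e \<inter> {x, y, z}) + card (e \<inter> ?I)"
    using e(2) by (metis Int_Un_distrib card_Un_le inf.absorb_iff1)
  ultimately show "2 \<le> card (e \<inter> {x, y, z})" using H3_card[OF e(1)] by linarith
qed (use assms adj_in_verts in auto)

text \<open>Leaving out \<open>e\<close>, \<open>d\<close> or \<open>b\<close> leaves a path through
  the other four vertices. The common vertices \<open>a\<close> and \<open>c\<close> are contracted.
  Chords of the four-cycle are allowed.\<close>

lemma not_mengerian_C4_pendant: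
  assumes "adj a b" "adj b c" "adj c d" "adj d a" "adj a e" "distinct [a, b, c, d, e]"
  shows "\<not> mengerian (pverts G) (H3 G)"
proof (rule not_mengerian_five_set[of b d e a c])
  note sym = assms(1-5)[THEN adj_sym]
  have "{a, b, c, d} \<in> H3 G" "{e, a, b, c} \<in> H3 G" "{e, a, d, c} \<in> H3 G"
    using assms sym by (intro H3_I; auto)+
  then show "{b, d, a, c} \<in> H3 G" "{b, e, a, c} \<in> H3 G" "{d, e, a, c} \<in> H3 G"
    by (simp_all add: insert_commute)
qed (use assms in auto)

lemma mengerian_no_C4:
  assumes conn: "Digraph_Component.connected (with_proj G)" and V: "5 \<le> card (pverts G)"
    and m: "mengerian (pverts G) (H3 G)"
    and C4: "adj a b" "adj b c" "adj c d" "adj d a" "distinct [a, b, c, d]"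
  shows False
proof -
  have "card {a, b, c, d} \<le> 4" by (simp add: card_insert_if)
  then have "{a, b, c, d} \<noteq> pverts G" using V by (intro notI) simp
  moreover have "{a, b, c, d} \<subseteq> pverts G" using C4 adj_in_verts by blast
  ultimately obtain u e where ue: "u \<in> {a, b, c, d}" "e \<in> pverts G - {a, b, c, d}" "adj u e"
    using connected_exit[OF conn, of "{a, b, c, d}"] by blast
  consider "u = a" | "u = b" | "u = c" | "u = d" using ue(1) by auto
  then have "\<not> mengerian (pverts G) (H3 G)"
  proof cases
    case 1 then show ?thesis using C4 ue by (intro not_mengerian_C4_pendant[of a b c d e]) auto
  next
    case 2 then show ?thesis using C4 ue by (intro not_mengerian_C4_pendant[of b c d a e]) auto
  next
    case 3 then show ?thesis using C4 ue by (intro not_mengerian_C4_pendant[of c d a b e]) auto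
  next
    case 4 then show ?thesis using C4 ue by (intro not_mengerian_C4_pendant[of d a b c e]) auto
  qed
  then show False using m by simp
qed

text \<open>The contracted pair is the edge \<open>a\<close>, \<open>b\<close> that carries both
  horns; any two of \<open>c\<close>, \<open>d\<close>, \<open>e\<close> extend it to a
  hyperedge.\<close>

lemma not_mengerian_bull:
  assumes "adj a b" "adj b c" "adj c a" "adj a d" "adj b e" "distinct [a, b, c, d, e]"
  shows "\<not> mengerian (pverts G) (H3 G)"
proof (rule not_mengerian_five_set[of c d e a b])
  note sym = assms(1-5)[THEN adj_sym]
  have "{d, a, b, e} \<in> H3 G" "{d, a, c, b} \<in> H3 G" "{e, b, c, a} \<in> H3 G"
    using assms sym by (intro H3_I; auto)+
  then show "{c, d, a, b} \<in> H3 G" "{d, e, a, b} \<in> H3 G" "{c, e, a, b} \<in> H3 G"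
    by (simp_all add: insert_commute)
qed (use assms in auto)

text \<open>The contracted pair is \<open>c\<close>, \<open>d\<close>; any two of \<open>a\<close>,
  \<open>b\<close>, \<open>e\<close> extend it to a hyperedge.\<close>

lemma not_mengerian_triangle_tail:
  assumes "adj a b" "adj b c" "adj c a" "adj c d" "adj d e" "distinct [a, b, c, d, e]"
  shows "\<not> mengerian (pverts G) (H3 G)"
proof (rule not_mengerian_five_set[of a b e c d])
  note sym = assms(1-5)[THEN adj_sym]
  have "{a, b, c, d} \<in> H3 G" "{a, c, d, e} \<in> H3 G" "{b, c, d, e} \<in> H3 G"
    using assms sym by (intro H3_I; auto)+
  then show "{a, b, c, d} \<in> H3 G" "{b, e, c, d} \<in> H3 G" "{a, e, c, d} \<in> H3 G"
    by (simp_all add: insert_commute)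
qed (use assms in auto)

text \<open>Let \<open>d\<close> hang on the corner \<open>c\<close>. Another neighbour of
  \<open>a\<close> or \<open>b\<close> would create a four-cycle or a bull; another neighbour of a
  vertex hanging on \<open>c\<close> would create a four-cycle or a tail. So the triangle together
  with the neighbours of \<open>c\<close> is closed under adjacency and is everything.\<close>

lemma mengerian_triangle_imp_star_with_extra_edge:
  assumes conn: "Digraph_Component.connected (with_proj G)" and V: "5 \<le> card (pverts G)"
    and m: "mengerian (pverts G) (H3 G)"
    and tri: "adj a b" "adj b c" "adj c a"
  shows "star_with_extra_edge G"
proof -
  have dist: "distinct [a, b, c]" using tri by auto
  note tri' = tri[THEN adj_sym]
  have "card {a, b, c} \<le> 3" by (simp add: card_insert_if)
  then have "{a, b, c} \<noteq> pverts G" using V by (intro notI) simp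
  moreover have "{a, b, c} \<subseteq> pverts G" using tri adj_in_verts by blast
  ultimately have "{a, b, c} \<subset> pverts G" by blast
  then obtain u d where ud: "u \<in> {a, b, c}" "d \<in> pverts G - {a, b, c}" "adj u d"
    using connected_exit[OF conn, of "{a, b, c}"] by blast
  obtain a b c where tri: "adj a b" "adj b c" "adj c a" and d: "adj c d" "d \<notin> {a, b, c}" 
  proof -
    consider "u = a" | "u = b" | "u = c" using ud by auto
    then show thesis
      by cases (use that[of b c a] that[of c a b] that[of a b c] tri ud in auto)
  qed
  note tri' = tri[THEN adj_sym]
  have dist: "distinct [a, b, c]" using tri by auto
  \<comment> \<open>The four-cycle runs from \<open>c\<close> over \<open>v\<close> to its neighbour
    \<open>s\<close> among \<open>a\<close>, \<open>b\<close> and returns over the remaining corner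
    \<open>r\<close>.\<close>
  have noC4: False if "adj v c" "adj v a \<or> adj v b" "v \<notin> {a, b, c}" for v
  proof -
    define s where "s = (if adj v a then a else b)"
    define r where "r = (if adj v a then b else a)"
    have C4: "adj c v" "adj v s" "adj s r" "adj r c" "distinct [c, v, s, r]"
      using that tri tri' dist adj_sym by (auto simp: s_def r_def)
    then show False using mengerian_no_C4[OF conn V m, of c v s r] by blast
  qed
  have ab: "v = c \<or> v \<in> {a, b}" if "adj u v" "u \<in> {a, b}" for u v
  proof (rule ccontr)
    assume v: "\<not> ?thesis"
    show False
    proof (cases "v = d")
      case True
      then show False using noC4[of d] d that adj_sym by auto
    next
      case False
      define r where "r = (if u = a then b else a)"
      have "\<not> mengerian (pverts G) (H3 G)"
        using not_mengerian_bull[of c u r d v] tri tri' dist d v that False by (auto simp: r_def)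
      then show False using m by simp
    qed
  qed
  have far: "v = c" if "adj u v" "adj u c" "u \<notin> {a, b, c}" for u v
  proof (rule ccontr)
    assume "v \<noteq> c"
    moreover have "v \<noteq> a" "v \<noteq> b" using noC4[of u] that by auto
    moreover have "u \<noteq> v" using that by auto
    ultimately have "\<not> mengerian (pverts G) (H3 G)"
      using not_mengerian_triangle_tail[of a b c u v] tri dist that adj_sym by auto
    then show False using m by simp
  qed
  let ?A = "{a, b, c} \<union> {v. adj v c}"
  have A: "?A = pverts G"
  proof (rule connected_closed[OF conn, of a])
    show "?A \<subseteq> pverts G" using adj_in_verts tri by auto
    fix u v assume uv: "u \<in> ?A" "adj u v"
    then consider "u \<in> {a, b}" | "u = c" | "adj u c" "u \<notin> {a, b, c}" by blast
    then show "v \<in> ?A"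
    proof cases
      case 1 then show ?thesis using ab[OF uv(2)] by blast
    next
      case 2 then show ?thesis using adj_sym[OF uv(2)] by simp
    next
      case 3 then show ?thesis using far[OF uv(2)] by blast
    qed
  qed simp
  have all: "adj v c" if "v \<in> pverts G" "v \<noteq> c" for v using that A tri tri' by auto
  have nbr: "u = c \<or> v = c \<or> {u, v} = {a, b}" if "adj u v" for u v
  proof (cases "u \<in> {a, b, c}")
    case True then show ?thesis using ab[of u v] that by auto
  next
    case False
    then show ?thesis using far[of u v] all[of u] that adj_in_verts by auto
  qed
  define S where "S = \<lparr> pverts = pverts G, parcs = {c} \<times> (pverts G - {c}) \<union> (pverts G - {c}) \<times> {c} \<rparr>"
  have c: "c \<in> pverts G" "a \<in> pverts G" "b \<in> pverts G" using tri adj_in_verts by auto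
  have S: "pverts S = pverts G"
    "\<And>u v. (u, v) \<in> parcs S \<longleftrightarrow> u = c \<and> v \<in> pverts G - {c} \<or> v = c \<and> u \<in> pverts G - {c}"
    by (auto simp: S_def)
  have "complete_bipartite_digraph 1 (card (pverts G - {c})) (with_proj S)"
    unfolding complete_bipartite_digraph_pair_def S_def
    by (rule conjI, simp add: pair_finite_verts, rule exI[of _ "{c}"], rule exI[of _ "pverts G - {c}"])
      (use c in auto)
  moreover have leaf: "leaf S v" if "v \<in> pverts G" "v \<noteq> c" for v
  proof -
    have "out_arcs (with_proj S) v = {(v, c)}" using that c by (auto simp: S out_arcs_def)
    then show ?thesis using that by (simp add: leaf_def out_degree_def S(1))
  qed
  moreover have "(u, v) \<in> parcs G \<longleftrightarrow> (u, v) \<in> parcs S \<union> {(a, b), (b, a)}" for u v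
  proof
    assume uv: "adj u v"
    then have "u \<noteq> v" by auto
    then show "(u, v) \<in> parcs S \<union> {(a, b), (b, a)}"
      using nbr[OF uv] adj_in_verts[OF uv] by (auto simp: S doubleton_eq_iff)
  next
    assume "(u, v) \<in> parcs S \<union> {(a, b), (b, a)}"
    then show "adj u v" using all[of u] adj_sym[OF all[of v]] tri tri' by (auto simp: S)
  qed
  then have "parcs G = parcs S \<union> {(a, b), (b, a)}" by auto
  moreover have "(a, b) \<notin> parcs S" "a \<noteq> b" using dist by (auto simp: S(2))
  moreover have "leaf S a" "leaf S b" using leaf c dist by auto
  ultimately show ?thesis unfolding star_with_extra_edge_def using S(1) by metis
qed

subsection \<open>Induced cycles\<close>

text \<open>The cycle is indexed by all integers, periodically modulo its length \<open>n\<close>.\<close>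

definition induced_cycle :: "int \<Rightarrow> (int \<Rightarrow> 'a) \<Rightarrow> bool" where
  "induced_cycle n v \<longleftrightarrow> range v \<subseteq> pverts G \<and> (\<forall>i j. v i = v j \<longleftrightarrow> i mod n = j mod n) \<and>
     (\<forall>i j. adj (v i) (v j) \<longleftrightarrow> (j - i) mod n = 1 \<or> (i - j) mod n = 1)"

lemma induced_cycle_eq_iff:
  assumes "induced_cycle n v"
  shows "v i = v j \<longleftrightarrow> n dvd i - j"
  using assms by (simp add: induced_cycle_def mod_eq_dvd_iff)

lemma induced_cycle_neq:
  assumes "induced_cycle n v" "i < j" "j < i + n"
  shows "v i \<noteq> v j"
  using assms zdvd_not_zless[of "j - i" n] by (simp add: induced_cycle_eq_iff dvd_diff_commute)

lemma induced_cycle_adj_iff: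
  assumes "induced_cycle n v" "1 < n"
  shows "adj (v i) (v j) \<longleftrightarrow> v j = v (i + 1) \<or> v j = v (i - 1)"
proof -
  have 1: "k mod n = 1 \<longleftrightarrow> n dvd k - 1" for k
    using assms(2) mod_eq_dvd_iff[of k n 1] by simp
  have "v j = v (i + 1) \<longleftrightarrow> n dvd j - i - 1" by (simp add: induced_cycle_eq_iff[OF assms(1)] algebra_simps)
  moreover have "v j = v (i - 1) \<longleftrightarrow> n dvd i - j - 1"
    using dvd_diff_commute[of n j "i - 1"] by (simp add: induced_cycle_eq_iff[OF assms(1)] algebra_simps)
  ultimately show ?thesis using assms(1) 1 by (simp add: induced_cycle_def)
qed

lemma window_eq: "v ` {s..s + 3 :: int} = {v s, v (s + 1), v (s + 2), v (s + 3)}"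
proof -
  have "{s..s + 3} = {s, s + 1, s + 2, s + 3}" by auto
  then show ?thesis by simp
qed

lemma induced_cycle_window_H3:
  assumes "induced_cycle n v" "5 \<le> n"
  shows "v ` {s..s + 3} \<in> H3 G"
  unfolding window_eq
proof (rule H3_I)
  show "adj (v s) (v (s + 1))" "adj (v (s + 1)) (v (s + 2))" "adj (v (s + 2)) (v (s + 3))"
    using assms by (simp_all add: induced_cycle_def)
  show "distinct [v s, v (s + 1), v (s + 2), v (s + 3)]"
    using assms by (simp add: induced_cycle_neq)
qed

text \<open>Without chords, a path inside the cycle can only step to a neighbouring position, and
  distinctness forbids turning back; the first step fixes the direction.\<close>

lemma induced_cycle_H3_window:
  assumes cyc: "induced_cycle n v" "5 \<le> n" and e: "e \<in> H3 G" "e \<subseteq> range v"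
  obtains s where "e = v ` {s..s + 3}"
proof -
  obtain a b c d where p: "e = {a, b, c, d}" "adj a b" "adj b c" "adj c d" "distinct [a, b, c, d]"
    using H3_E[OF e(1)] .
  have step: "y = v (i + 1) \<or> y = v (i - 1)" if "adj (v i) y" "y \<in> range v" for i y
    using that induced_cycle_adj_iff[OF cyc(1)] cyc(2) by auto
  obtain i where i: "a = v i" using e(2) p(1) by auto
  have "b = v (i + 1) \<or> b = v (i - 1)" using step[of i b] p e(2) i by auto
  then show thesis
  proof
    assume b: "b = v (i + 1)"
    have c: "c = v (i + 2)" using step[of "i + 1" c] p e(2) i b by (auto simp: add.commute)
    have "d = v (i + 3)" using step[of "i + 2" d] p e(2) b c by (auto simp: add.commute)
    then show thesis using that[of i] p(1) i b c unfolding window_eq by auto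
  next
    assume b: "b = v (i - 1)"
    have c: "c = v (i - 2)" using step[of "i - 1" c] p e(2) i b by (auto simp: add.commute)
    have "d = v (i - 3)" using step[of "i - 2" d] p e(2) b c by (auto simp: add.commute)
    then show thesis using that[of "i - 3"] p(1) i b c unfolding window_eq by auto
  qed
qed

lemma induced_cycle_range:
  assumes "induced_cycle n v" "0 < n"
  shows "range v = (\<lambda>i. v (int i)) ` {..<nat n}"
proof -
  have "v i = v (int (nat (i mod n)))" "nat (i mod n) < nat n" for i
    using assms by (simp_all add: induced_cycle_def)
  then show ?thesis by blast
qed

text \<open>The cyclic obstruction applies with \<open>N = n\<close> and \<open>k = 4\<close>,
  nothing being contracted: all vertices off the cycle receive weight 0.\<close>

lemma not_mengerian_induced_cycle_not_dvd_4:
  assumes cyc: "induced_cycle n v" "5 \<le> n" "\<not> 4 dvd n"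
  shows "\<not> mengerian (pverts G) (H3 G)"
proof -
  define N where "N = nat n"
  have n: "n = int N" "0 < N" using cyc(2) by (simp_all add: N_def)
  have R: "(\<lambda>i. v (int i)) ` {..<N} = range v"
    using induced_cycle_range[OF cyc(1)] cyc(2) by (simp add: N_def)
  show ?thesis
  proof (rule not_mengerian_cyclic[where u = "\<lambda>i. v (int i)" and N = N and D = "{}" and k = 4
        and E = "\<lambda>i. v ` {int i..int i + 3}"], unfold R)
    show "inj_on (\<lambda>i. v (int i)) {..<N}"
    proof (rule linorder_inj_onI')
      fix i j assume "i \<in> {..<N}" "j \<in> {..<N}" "i < j"
      then show "v (int i) \<noteq> v (int j)" using induced_cycle_neq[OF cyc(1), of "int i" "int j"] n by auto
    qed
    show "\<not> 4 dvd N" using cyc(3) n int_dvd_int_iff[of 4 N] by simp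
    fix i
    show "v ` {int i..int i + 3} \<inter> range v \<subseteq> (\<lambda>t. v (int ((i + t) mod N))) ` {..<4}"
    proof -
      have m: "v (int ((i + t) mod N)) = v (int i + int t)" for t
        using cyc(1) n by (simp add: induced_cycle_def of_nat_mod)
      have "{..<4::nat} = {0, 1, 2, 3}" by auto
      then show ?thesis unfolding window_eq m by auto
    qed
  next
    fix e assume "e \<in> H3 G" "e \<subseteq> range v \<union> {}"
    then show "4 \<le> card (e \<inter> range v)" using H3_card[of e] by (simp add: Int_absorb2)
  qed (use cyc pair_finite_verts H3_subset induced_cycle_window_H3[OF cyc(1,2)] in \<open>auto simp: induced_cycle_def\<close>)
qed

text \<open>Contracting all vertices but those at \<open>0, 1, 3, 5, 6, 8, 10, \<dots>, n - 2\<close> turns the windows into the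
  edges of an odd cycle of length \<open>n / 2 + 1\<close>; the two gaps of length 1 must be far enough apart,
  which requires \<open>n \<ge> 12\<close>.\<close>

lemma not_mengerian_induced_cycle_dvd_4:
  assumes cyc: "induced_cycle n v" and n: "n = 4 * int q" "3 \<le> q"
  shows "\<not> mengerian (pverts G) (H3 G)"
proof -
  have n5: "5 \<le> n" using n by simp
  define p where "p i = (if i = 0 then 0 else if i \<le> 3 then 2 * int i - 1 else 2 * int i - 2)" for i :: nat
  \<comment> \<open>The window at \<open>st i\<close> meets the kept positions only in
    \<open>p i\<close> and its cyclic successor. The irregular starts are due to the two gaps of
    length 1, near which a window can meet three kept positions, as \<open>{0..3}\<close> does; the
    last window wraps around to position 0.\<close>
  define st where "st i = (if i = 0 then - 1 else if i \<le> 2 then int i else if i = 3 then 4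
    else if i < 2 * q then 2 * int i - 2 else 2 * int i - 3)" for i :: nat
  define N where "N = 2 * q + 1"
  define U where "U = (\<lambda>i. v (p i)) ` {..<N}"
  have p: "0 \<le> p i" "p i \<le> n - 2" if "i < N" for i using that n by (auto simp: p_def N_def)
  have pmono: "p i < p j" if "i < j" for i j using that by (auto simp: p_def)
  have shift: "v (i + n) = v i" for i using cyc by (simp add: induced_cycle_def)
  show ?thesis
  proof (rule not_mengerian_cyclic[where u = "\<lambda>i. v (p i)" and N = N and D = "range v - U" and k = 2
        and E = "\<lambda>i. v ` {st i..st i + 3}"], unfold U_def[symmetric])
    show "inj_on (\<lambda>i. v (p i)) {..<N}"
    proof (rule linorder_inj_onI')
      fix i j assume "i \<in> {..<N}" "j \<in> {..<N}" "i < j"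
      then show "v (p i) \<noteq> v (p j)" using induced_cycle_neq[OF cyc, of "p i" "p j"] pmono p[of i] p[of j] by auto
    qed
    show "\<not> 2 dvd N" by (simp add: N_def)
    show "U \<union> (range v - U) \<subseteq> pverts G" using cyc by (auto simp: U_def induced_cycle_def)
    fix i assume i: "i < N"
    show "v ` {st i..st i + 3} \<subseteq> U \<union> (range v - U)" by auto
    show "v ` {st i..st i + 3} \<inter> U \<subseteq> (\<lambda>t. v (p ((i + t) mod N))) ` {..<2}"
    proof
      fix w assume "w \<in> v ` {st i..st i + 3} \<inter> U"
      then have w: "w \<in> v ` {st i..st i + 3}" "w \<in> U" by blast+
      obtain r where r: "w = v r" "st i \<le> r" "r \<le> st i + 3" using w(1) by auto
      obtain j where j: "w = v (p j)" "j < N" using w(2) by (auto simp: U_def)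
      have "n dvd r - p j" using r j induced_cycle_eq_iff[OF cyc] by metis
      then obtain k where k: "r - p j = n * k" by (elim dvdE)
      \<comment> \<open>So \<open>r\<close> lies between \<open>- 1\<close> and \<open>n\<close>,
        while \<open>p j\<close> lies between 0 and \<open>n - 2\<close>: the window wraps at most
        once and \<open>k\<close> is 0 or 1.\<close>
      have st: "- 1 \<le> st i" "st i \<le> n - 3" using i n by (auto simp: st_def N_def)
      have "- n < n * k" "n * k < 2 * n" using k st r(2,3) p[OF j(2)] n5 by linarith+
      then have "- 1 < k" "k < 2"
        using n5 mult_less_cancel_left_pos[of n "- 1" k] mult_less_cancel_left_pos[of n k 2] by auto
      then have "k = 0 \<or> k = 1" by auto
      then have "j = i \<or> j = Suc i \<or> (i = 2 * q \<and> j = 0)"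
      proof
        assume "k = 0"
        then have "r = p j" using k by simp
        then show ?thesis using r(2,3) i j(2) n unfolding p_def st_def N_def
          by (auto split: if_splits; presburger)
      next
        assume "k = 1"
        then have "r = p j + n" using k by simp
        then show ?thesis using r(2,3) i j(2) n st p[OF j(2)] unfolding p_def st_def N_def
          by (auto split: if_splits)
      qed
      then have "j = (i + 0) mod N \<or> j = (i + 1) mod N" using i j(2) by (auto simp: N_def)
      then show "w \<in> (\<lambda>t. v (p ((i + t) mod N))) ` {..<2}" using j(1) by fastforce
    qed
  next
    fix e assume e: "e \<in> H3 G" "e \<subseteq> U \<union> (range v - U)"
    have "U \<subseteq> range v" by (auto simp: U_def)
    then have "e \<subseteq> range v" using e(2) by blast
    then obtain s' where s': "e = v ` {s'..s' + 3}" using induced_cycle_H3_window[OF cyc n5 e(1)] by blast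
    define s where "s = s' mod n"
    have s: "0 \<le> s" "s < n" using n5 by (simp_all add: s_def)
    have "v (s + k) = v (s' + k)" for k using cyc by (simp add: s_def induced_cycle_def mod_simps)
    from this[of 0] this[of 1] this[of 2] this[of 3] have es: "e = v ` {s..s + 3}"
      unfolding s' window_eq by simp
    \<comment> \<open>The second alternative records kept positions met after wrapping past
      \<open>n\<close>; as \<open>s < n\<close>, one turn is enough.\<close>
    let ?in = "\<lambda>j. j < N \<and> (s \<le> p j \<and> p j \<le> s + 3 \<or> s \<le> p j + n \<and> p j + n \<le> s + 3)"
    have "\<exists>i j. i < j \<and> ?in i \<and> ?in j"
    proof -
      consider "s = 0" | "s = 1" | "s = 2 \<or> s = 3" | "s = 4 \<or> s = 5"
        | m where "3 \<le> m" "s = 2 * int m \<or> s = 2 * int m - 1" "m < 2 * q - 1"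
        | "s = n - 3 \<or> s = n - 2" | "s = n - 1"
      proof -
        define m where "m = nat ((s + 1) div 2)"
        have im: "int m = (s + 1) div 2" using s by (simp add: m_def)
        have sm: "s = 2 * int m \<or> s = 2 * int m - 1" unfolding im by presburger
        show thesis
        proof (cases "s \<le> 5 \<or> n - 3 \<le> s")
          case True
          then have "s = 0 \<or> s = 1 \<or> s = 2 \<or> s = 3 \<or> s = 4 \<or> s = 5 \<or> s = n - 3 \<or> s = n - 2 \<or> s = n - 1"
            using s by linarith
          then show thesis using that(1-4,6,7) by blast
        next
          case False
          then show thesis using sm n by (intro that(5)[of m]) auto
        qed
      qed
      then show ?thesis
      proof cases
        case 1 then show ?thesis using n by (intro exI[of _ 0] exI[of _ 1]) (auto simp: p_def N_def)
      next
        case 2 then show ?thesis using n by (intro exI[of _ 1] exI[of _ 2]) (auto simp: p_def N_def)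
      next
        case 3 then show ?thesis using n by (intro exI[of _ 2] exI[of _ 3]) (auto simp: p_def N_def)
      next
        case 4 then show ?thesis using n by (intro exI[of _ 3] exI[of _ 4]) (auto simp: p_def N_def)
      next
        case (5 m)
        then show ?thesis using n by (intro exI[of _ "m + 1"] exI[of _ "m + 2"]) (auto simp: p_def N_def)
      next
        case 6 then show ?thesis using n by (intro exI[of _ 0] exI[of _ "2 * q"]) (auto simp: p_def N_def)
      next
        case 7 then show ?thesis using n by (intro exI[of _ 0] exI[of _ 1]) (auto simp: p_def N_def)
      qed
    qed
    then obtain i j where ij: "i < j" "?in i" "?in j" by blast
    have "v (p j) \<in> e \<inter> U" if "?in j" for j
    proof -
      have "v (p j) \<in> e" using that shift[of "p j"] unfolding es
        by (metis atLeastAtMost_iff image_eqI)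
      then show ?thesis using that by (auto simp: U_def)
    qed
    then have "{v (p i), v (p j)} \<subseteq> e \<inter> U" using ij by blast
    moreover have "v (p i) \<noteq> v (p j)"
      using pmono[OF ij(1)] p[of i] p[of j] ij n5 by (intro induced_cycle_neq[OF cyc]) linarith+
    ultimately show "2 \<le> card (e \<inter> U)"
      using card_mono[of "e \<inter> U" "{v (p i), v (p j)}"] by (simp add: U_def)
  qed (use pair_finite_verts H3_subset induced_cycle_window_H3[OF cyc n5] in auto)
qed

lemma mengerian_induced_cycle_imp_eq_8:
  assumes "mengerian (pverts G) (H3 G)" "induced_cycle n v" "5 \<le> n"
  shows "n = 8"
proof -
  have "4 dvd n" using not_mengerian_induced_cycle_not_dvd_4 assms by blast
  then obtain k where k: "n = 4 * k" by (elim dvdE)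
  have "\<not> 3 \<le> nat k" using not_mengerian_induced_cycle_dvd_4[OF assms(2), of "nat k"] assms k by auto
  then have "k = 2" using assms(3) k by auto
  then show ?thesis using k by simp
qed

text \<open>An outside neighbour \<open>z\<close> of \<open>v i\<close> is the extra leg of a spider
  whose spine is the stretch from \<open>v (i - 2)\<close> to \<open>v (i + 2)\<close>. Both ends
  and the middle of this stretch are pairwise nonadjacent on eight vertices, and \<open>z\<close>
  may have further neighbours on the cycle.\<close>

lemma mengerian_induced_C8_spanning:
  assumes conn: "Digraph_Component.connected (with_proj G)"
    and m: "mengerian (pverts G) (H3 G)" and cyc: "induced_cycle 8 v"
  shows "range v = pverts G"
proof (rule ccontr)
  assume "range v \<noteq> pverts G"
  then have "range v \<subset> pverts G" using cyc by (auto simp: induced_cycle_def)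
  then obtain w z where wz: "w \<in> range v" "z \<in> pverts G - range v" "adj w z"
    using connected_exit[OF conn, of "range v"] by blast
  then obtain i where i: "w = v i" by blast
  have neq: "v j \<noteq> v k" if "j < k" "k < j + 8" for j k using induced_cycle_neq[OF cyc] that by blast
  have "\<not> mengerian (pverts G) (H3 G)"
  proof (rule not_mengerian_spider[of "v (i - 2)" "v (i - 1)" "v i" "v (i + 1)" "v (i + 2)" z])
    show "distinct [v (i - 2), v (i - 1), v i, v (i + 1), v (i + 2), z]"
      using wz(2) by (auto simp: neq)
    show "\<not> adj (v i) (v (i - 2))" "\<not> adj (v i) (v (i + 2))" "\<not> adj (v (i - 2)) (v (i + 2))"
      using cyc by (simp_all add: induced_cycle_def)
  qed (use cyc i wz(3) in \<open>simp_all add: induced_cycle_def\<close>)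
  then show False using m by simp
qed

section \<open>Chordless circuits, induced cycles and isomorphism with the eight-cycle\<close>

lemma circuit_chordless_induced_cycle:
  assumes "circuit p"
    and chordless: "\<And>i j. i < j \<Longrightarrow> j < length p \<Longrightarrow> adj (p ! i) (p ! j) \<Longrightarrow>
      j = Suc i \<or> (i = 0 \<and> j = length p - 1)"
  shows "induced_cycle (int (length p)) (\<lambda>k. p ! nat (k mod int (length p)))"
proof -
  define n where "n = length p"
  have n: "3 \<le> n" "distinct p" "successively adj p" "adj (last p) (hd p)"
    using assms(1) by (auto simp: circuit_def n_def)
  have ne: "p \<noteq> []" using n(1) by (auto simp: n_def)
  have ends: "adj (p ! (n - 1)) (p ! 0)"
    using n(4) ne by (simp add: last_conv_nth hd_conv_nth n_def)
  have idx: "nat (k mod int n) < n" for k using n(1) by (simp add: nat_less_iff)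
  have adj_iff: "adj (p ! a) (p ! b) \<longleftrightarrow>
      b = Suc a \<or> a = Suc b \<or> (a = 0 \<and> b = n - 1) \<or> (b = 0 \<and> a = n - 1)"
    if "a < n" "b < n" for a b
  proof
    assume ab: "adj (p ! a) (p ! b)"
    then have "a \<noteq> b" by auto
    then consider "a < b" | "b < a" by linarith
    then show "b = Suc a \<or> a = Suc b \<or> (a = 0 \<and> b = n - 1) \<or> (b = 0 \<and> a = n - 1)"
      by cases (use chordless[of a b] chordless[of b a] ab adj_sym[OF ab] that in \<open>auto simp: n_def\<close>)
  next
    assume "b = Suc a \<or> a = Suc b \<or> (a = 0 \<and> b = n - 1) \<or> (b = 0 \<and> a = n - 1)"
    moreover have "adj (p ! k) (p ! Suc k)" if "Suc k < n" for k
      using n(3) that by (simp add: successively_conv_nth n_def)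
    ultimately show "adj (p ! a) (p ! b)" using ends that adj_sym by auto
  qed
  have diff: "(j - i) mod int n = 1 \<longleftrightarrow>
      nat (j mod int n) = Suc (nat (i mod int n)) \<or> (nat (j mod int n) = 0 \<and> nat (i mod int n) = n - 1)" for i j
  proof -
    define a where "a = i mod int n"
    define b where "b = j mod int n"
    have ab: "0 \<le> a" "a < int n" "0 \<le> b" "b < int n" using n(1) by (auto simp: a_def b_def)
    have "(j - i) mod int n = (b - a) mod int n" by (simp add: a_def b_def mod_diff_eq)
    also have "\<dots> = (if a \<le> b then b - a else b - a + int n)"
    proof (cases "a \<le> b")
      case False
      have "(b - a) mod int n = (b - a + int n) mod int n" by simp
      also have "\<dots> = b - a + int n" using ab False by (intro mod_pos_pos_trivial) auto
      finally show ?thesis using False by simp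
    qed (use ab in auto)
    finally show ?thesis using ab n(1) by (fold a_def b_def) (auto split: if_splits)
  qed
  show ?thesis unfolding induced_cycle_def n_def[symmetric]
  proof (intro conjI allI)
    show "range (\<lambda>k. p ! nat (k mod int n)) \<subseteq> pverts G"
    proof clarify
      fix k
      define a where "a = nat (k mod int n)"
      define b where "b = (if a = 0 then n - 1 else a - 1)"
      have "a < n" using idx by (simp add: a_def)
      then have "adj (p ! a) (p ! b)" using n(1) by (subst adj_iff) (auto simp: b_def)
      then show "p ! nat (k mod int n) \<in> pverts G" using adj_in_verts(1) by (simp add: a_def)
    qed
    fix i j
    show "p ! nat (i mod int n) = p ! nat (j mod int n) \<longleftrightarrow> i mod int n = j mod int n"
      using nth_eq_iff_index_eq[OF n(2), of "nat (i mod int n)" "nat (j mod int n)"] idx[of i] idx[of j] n(1)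
      by (simp add: eq_nat_nat_iff flip: n_def)
    show "adj (p ! nat (i mod int n)) (p ! nat (j mod int n)) \<longleftrightarrow>
        (j - i) mod int n = 1 \<or> (i - j) mod int n = 1"
      unfolding diff adj_iff[OF idx idx] by blast
  qed
qed

lemma parcs_cycle_graph_8:
  "(nat (i mod 8), nat (j mod 8)) \<in> parcs (cycle_graph 8) \<longleftrightarrow> (j - i) mod 8 = 1 \<or> (i - j) mod 8 = 1"
proof -
  have "nat (j mod 8) = Suc (nat (i mod 8)) mod 8 \<longleftrightarrow> (j - i) mod 8 = 1" for i j :: int
  proof -
    have "nat (j mod 8) = Suc (nat (i mod 8)) mod 8 \<longleftrightarrow> j mod 8 = (1 + i mod 8) mod 8"
      by (subst of_nat_eq_iff[where 'a = int, symmetric]) (simp add: of_nat_mod)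
    also have "\<dots> \<longleftrightarrow> 8 dvd j - (1 + i)" by (simp add: mod_simps mod_eq_dvd_iff)
    also have "\<dots> \<longleftrightarrow> (j - i) mod 8 = 1" using mod_eq_dvd_iff[of "j - i" 8 1] by (simp add: algebra_simps)
    finally show ?thesis .
  qed
  then show ?thesis by (simp add: cycle_graph_def nat_less_iff)
qed

lemma digraph_iso_C8_imp_induced_cycle:
  assumes "digraph_iso (with_proj G) (with_proj (cycle_graph 8))"
  obtains v where "induced_cycle 8 v" "range v = pverts G"
proof -
  obtain f where f: "digraph_isomorphism f" "with_proj (cycle_graph 8) = app_iso f (with_proj G)"
    using assms unfolding digraph_iso_def by blast
  define h where "h = iso_verts f"
  have inj: "inj_on h (pverts G)" using f(1) by (simp add: digraph_isomorphism_def h_def)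
  have im: "h ` pverts G = {..<8}"
    using arg_cong[OF f(2), of verts] by (simp add: h_def cycle_graph_def)
  have arcs: "parcs (cycle_graph 8) = iso_arcs f ` parcs G"
    using arg_cong[OF f(2), of arcs] by simp
  have tl: "fst = iso_tail f" "snd = iso_head f"
    using arg_cong[OF f(2), of tail] arg_cong[OF f(2), of head] by simp_all
  \<comment> \<open>The arc map of the isomorphism is determined by its vertex map, because the
    image digraph has the two projections as tail and head.\<close>
  have ia: "iso_arcs f (u, w) = (h u, h w)" if "adj u w" for u w
  proof -
    have "h u = iso_tail f (iso_arcs f (u, w)) \<and> h w = iso_head f (iso_arcs f (u, w))"
      using f(1) that by (auto simp: digraph_isomorphism_def h_def)
    then show ?thesis by (metis tl prod.collapse)
  qed
  have adj_iff: "adj u w \<longleftrightarrow> (h u, h w) \<in> parcs (cycle_graph 8)"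
    if uw: "u \<in> pverts G" "w \<in> pverts G" for u w
  proof
    assume "adj u w"
    then show "(h u, h w) \<in> parcs (cycle_graph 8)" using ia[of u w] arcs by (metis image_eqI)
  next
    assume "(h u, h w) \<in> parcs (cycle_graph 8)"
    then obtain a b where ab: "adj a b" "(h u, h w) = iso_arcs f (a, b)" using arcs by auto
    then have "h u = h a" "h w = h b" using ia[OF ab(1)] by auto
    then show "adj u w" using inj uw ab(1) adj_in_verts[OF ab(1)] by (auto simp: inj_on_def)
  qed
  define v where "v k = the_inv_into (pverts G) h (nat (k mod 8))" for k :: int
  have h8: "nat (k mod 8) \<in> h ` pverts G" for k :: int by (simp add: im nat_less_iff)
  have hv: "h (v k) = nat (k mod 8)" for k
    unfolding v_def using inj h8 by (rule f_the_inv_into_f)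
  have vV: "v k \<in> pverts G" for k
    unfolding v_def using inj h8 by (rule the_inv_into_into) simp
  have "induced_cycle 8 v"
    unfolding induced_cycle_def
  proof (intro conjI allI)
    show "range v \<subseteq> pverts G" using vV by auto
    fix i j
    show "v i = v j \<longleftrightarrow> i mod 8 = j mod 8"
      using inj_on_eq_iff[OF inj vV vV] hv by (metis nat_eq_iff2 pos_mod_sign zero_less_numeral v_def)
    show "adj (v i) (v j) \<longleftrightarrow> (j - i) mod 8 = 1 \<or> (i - j) mod 8 = 1"
      unfolding adj_iff[OF vV vV] hv by (rule parcs_cycle_graph_8)
  qed
  moreover have "range v = pverts G"
  proof
    show "pverts G \<subseteq> range v"
    proof
      fix u assume u: "u \<in> pverts G"
      then have "h u < 8" using im by auto
      then have "h u = h (v (int (h u)))" by (simp add: hv)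
      then show "u \<in> range v" using inj u vV by (metis inj_onD rangeI)
    qed
  qed (use vV in auto)
  ultimately show thesis by (rule that)
qed

lemma induced_C8_imp_digraph_iso:
  assumes cyc: "induced_cycle 8 v" and V: "range v = pverts G"
  shows "digraph_iso (with_proj G) (with_proj (cycle_graph 8))"
proof -
  define g where "g i = v (int i)" for i :: nat
  have inj: "inj_on g {..<8}"
    using cyc by (auto simp: inj_on_def g_def induced_cycle_def)
  have im: "g ` {..<8} = pverts G" using induced_cycle_range[OF cyc] V by (simp add: g_def)
  define h where "h = the_inv_into {..<8} g"
  have hg: "h (g i) = i" if "i < 8" for i unfolding h_def using inj that by (simp add: the_inv_into_f_f)
  have bij: "bij_betw h (pverts G) {..<8}"
    unfolding h_def using inj im by (intro bij_betw_the_inv_into) (simp add: bij_betw_def)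
  have adj_g: "adj (g i) (g j) \<longleftrightarrow> (i, j) \<in> parcs (cycle_graph 8)" if "i < 8" "j < 8" for i j
    using cyc that parcs_cycle_graph_8[of "int i" "int j"] by (simp add: induced_cycle_def g_def)
  define f where "f = \<lparr> iso_verts = h, iso_arcs = map_prod h h, iso_head = snd, iso_tail = fst \<rparr>"
  have "digraph_isomorphism f"
    unfolding digraph_isomorphism_def
  proof (intro conjI)
    show "wf_digraph (with_proj G)" by unfold_locales
    show "inj_on (iso_verts f) (pverts G)" using bij by (simp add: f_def bij_betw_def)
    then have "inj_on (map_prod h h) (pverts G \<times> pverts G)"
      by (intro map_prod_inj_on) (simp_all add: f_def)
    moreover have "parcs G \<subseteq> pverts G \<times> pverts G" using adj_in_verts by auto
    ultimately show "inj_on (iso_arcs f) (parcs G)" by (auto simp: f_def intro: inj_on_subset)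
  qed (auto simp: f_def)
  moreover have "with_proj (cycle_graph 8) = app_iso f (with_proj G)"
  proof (intro pre_digraph.equality)
    show "arcs (with_proj (cycle_graph 8)) = arcs (app_iso f (with_proj G))"
    proof (simp add: f_def, intro equalityI subsetI)
      fix x assume x: "x \<in> parcs (cycle_graph 8)"
      then obtain i j where ij: "x = (i, j)" "i < 8" "j < 8" by (auto simp: cycle_graph_def)
      then have "adj (g i) (g j)" using x adj_g by simp
      moreover have "x = map_prod h h (g i, g j)" using ij hg by simp
      ultimately show "x \<in> map_prod h h ` parcs G" by blast
    next
      fix x assume "x \<in> map_prod h h ` parcs G"
      then obtain a b where ab: "adj a b" "x = (h a, h b)" by auto
      have "a \<in> g ` {..<8}" "b \<in> g ` {..<8}" using adj_in_verts[OF ab(1)] im by simp_all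
      then obtain i j where "a = g i" "b = g j" "i < 8" "j < 8" by blast
      then show "x \<in> parcs (cycle_graph 8)" using ab adj_g hg by simp
    qed
  qed (use bij in \<open>auto simp: f_def cycle_graph_def bij_betw_def\<close>)
  ultimately show ?thesis unfolding digraph_iso_def by blast
qed

lemma mengerian_spanning_induced_C8:
  assumes cyc: "induced_cycle 8 v" and V: "range v = pverts G"
  shows "mengerian (pverts G) (H3 G)"
proof -
  have "H3 G = range (\<lambda>s. v ` {s..s + 3})"
  proof (intro equalityI subsetI)
    fix e assume e: "e \<in> H3 G"
    then have "e \<subseteq> range v" using H3_subset V by auto
    then obtain s where "e = v ` {s..s + 3}" using induced_cycle_H3_window[OF cyc _ e] by auto
    then show "e \<in> range (\<lambda>s. v ` {s..s + 3})" by blast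
  qed (use induced_cycle_window_H3[OF cyc] in auto)
  then show ?thesis using mengerian_C8_windows[of v] cyc V by (simp add: induced_cycle_def)
qed

section \<open>Sufficiency for four vertices and for stars with an extra edge\<close>

lemma mengerian_four_vertices:
  assumes "card (pverts G) = 4"
  shows "mengerian (pverts G) (H3 G)"
proof (cases "H3 G = {}")
  case True then show ?thesis by (simp add: mengerian_empty)
next
  case False
  have eq: "e = pverts G" if "e \<subseteq> pverts G" "card e = 4" for e
    using that assms pair_finite_verts by (metis card_subset_eq)
  then have H: "H3 G = {pverts G}" using False H3_subset H3_card by blast
  \<comment> \<open>With one hyperedge, any enumeration of the vertices is a layering by
    singletons.\<close>
  obtain pos where pos: "bij_betw pos (pverts G) {0..<4::nat}"
    using ex_bij_betw_finite_nat[OF pair_finite_verts] assms by auto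
  have "{e. e \<subseteq> pverts G \<and> (\<exists>i. bij_betw pos e {i..<i + 4})} = {pverts G}"
  proof (intro equalityI subsetI)
    fix e assume "e \<in> {e. e \<subseteq> pverts G \<and> (\<exists>i. bij_betw pos e {i..<i + 4})}"
    then show "e \<in> {pverts G}" using eq[of e] bij_betw_same_card[of pos e] by auto
  qed (use pos in \<open>auto intro: exI[of _ 0]\<close>)
  then show ?thesis using mengerian_windows[OF pair_finite_verts, of 4 pos] H by simp
qed

text \<open>The layers are the centre, \<open>a\<close>, \<open>b\<close>, and all other leaves
  together. They do not follow the path, which visits \<open>z\<close>, \<open>c\<close>,
  \<open>a\<close>, \<open>b\<close>; only the set of layers met by a hyperedge matters.\<close>

lemma star_with_extra_edge_imp_mengerian:
  assumes "star_with_extra_edge G"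
  shows "mengerian (pverts G) (H3 G)"
proof -
  obtain S n a b where S: "complete_bipartite_digraph 1 n (with_proj S)" "leaf S a" "leaf S b"
      "a \<noteq> b" "(a, b) \<notin> parcs S" "pverts G = pverts S" "parcs G = parcs S \<union> {(a, b), (b, a)}"
    using assms unfolding star_with_extra_edge_def by blast
  obtain C L where CL: "pverts S = C \<union> L" "C \<inter> L = {}" "card C = 1" "parcs S = C \<times> L \<union> L \<times> C"
    using S(1) unfolding complete_bipartite_digraph_pair_def by blast
  obtain c where c: "C = {c}" using CL(3) by (auto simp: card_1_singleton_iff)
  have V: "pverts G = insert c L" "c \<notin> L" using CL S(6) c by auto
  have ab: "a \<in> L" "b \<in> L"
  proof -
    have "a \<in> insert c L" "b \<in> insert c L" using S(2,3,6) V by (auto simp: leaf_def)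
    then show "a \<in> L" "b \<in> L" using S(4,5) CL(4) c by auto
  qed
  have adj_iff: "adj u w \<longleftrightarrow> (u = c \<and> w \<in> L) \<or> (w = c \<and> u \<in> L) \<or> (u = a \<and> w = b) \<or> (u = b \<and> w = a)" for u w
    using S(7) CL(4) c by auto
  define pos where "pos v = (if v = c then 0 else if v = a then 1 else if v = b then 2 else 3 :: nat)" for v
  have "H3 G = {e. e \<subseteq> pverts G \<and> (\<exists>i. bij_betw pos e {i..<i + 4})}"
  proof (intro equalityI subsetI)
    fix e assume e: "e \<in> H3 G"
    obtain p q r s where p: "e = {p, q, r, s}" "adj p q" "adj q r" "adj r s" "distinct [p, q, r, s]"
      using H3_E[OF e] .
    have "\<exists>z. z \<in> L \<and> z \<noteq> a \<and> z \<noteq> b \<and> e = {c, a, b, z}"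
      using p V(2) ab unfolding adj_iff by (auto simp: insert_commute)
    then obtain z where z: "z \<in> L" "z \<noteq> a" "z \<noteq> b" "e = {c, a, b, z}" by blast
    have "{0..<0 + 4} = {0, 1, 2, 3::nat}" by auto
    then have "bij_betw pos e {0..<0 + 4}"
      using z ab V(2) S(4) by (auto simp: bij_betw_def pos_def inj_on_def)
    then show "e \<in> {e. e \<subseteq> pverts G \<and> (\<exists>i. bij_betw pos e {i..<i + 4})}"
      using e H3_subset by blast
  next
    fix e assume "e \<in> {e. e \<subseteq> pverts G \<and> (\<exists>i. bij_betw pos e {i..<i + 4})}"
    then obtain i where e: "e \<subseteq> pverts G" "inj_on pos e" "pos ` e = {i..<i + 4}"
      by (auto simp: bij_betw_def)
    have "i + 3 \<in> pos ` e" using e(3) by simp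
    then have "i = 0" by (auto simp: pos_def split: if_splits)
    then have im: "pos ` e = {0, 1, 2, 3}" using e(3) by auto
    have pre: "\<exists>x\<in>e. pos x = k" if "k \<in> {0, 1, 2, 3}" for k
      using that unfolding im[symmetric] by blast
    obtain x0 where x0: "x0 \<in> e" "pos x0 = 0" using pre[of 0] by auto
    obtain x1 where x1: "x1 \<in> e" "pos x1 = 1" using pre[of 1] by auto
    obtain x2 where x2: "x2 \<in> e" "pos x2 = 2" using pre[of 2] by auto
    obtain z where z: "z \<in> e" "pos z = 3" using pre[of 3] by auto
    note x = x0 x1 x2
    have "x0 = c" "x1 = a" "x2 = b" using x by (auto simp: pos_def split: if_splits)
    then have "c \<in> e" "a \<in> e" "b \<in> e" using x by auto
    have "e = {c, a, b, z}"
    proof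
      show "e \<subseteq> {c, a, b, z}"
      proof
        fix x assume "x \<in> e"
        then have "pos x = pos z \<Longrightarrow> x = z" using z inj_onD[OF e(2), of x z] by blast
        moreover have "pos x = pos z" if "x \<notin> {c, a, b}" using that z(2) by (auto simp: pos_def)
        ultimately show "x \<in> {c, a, b, z}" by blast
      qed
    qed (use \<open>c \<in> e\<close> \<open>a \<in> e\<close> \<open>b \<in> e\<close> z in auto)
    moreover have "z \<in> L" "z \<noteq> a" "z \<noteq> b" using z e(1) V by (auto simp: pos_def split: if_splits)
    then have "{z, c, a, b} \<in> H3 G"
      using ab V(2) S(4) by (intro H3_I) (auto simp: adj_iff)
    ultimately show "e \<in> H3 G" by (simp add: insert_commute)
  qed
  then show ?thesis using mengerian_windows[OF pair_finite_verts, of 4 pos] by simp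
qed

subsection \<open>Trees\<close>

text \<open>Non-backtracking walks.\<close>

fun nbwalk :: "'a list \<Rightarrow> bool" where
  "nbwalk (x # y # z # r) \<longleftrightarrow> adj x y \<and> x \<noteq> z \<and> nbwalk (y # z # r)"
| "nbwalk [x, y] \<longleftrightarrow> adj x y"
| "nbwalk _ \<longleftrightarrow> True"

text \<open>An overlap of two vertices suffices, since backtracking shows on three consecutive
  vertices.\<close>

lemma nbwalk_glue:
  "nbwalk (a @ [x, y]) \<Longrightarrow> nbwalk (x # y # b) \<Longrightarrow> nbwalk (a @ x # y # b)"
  by (induction a rule: nbwalk.induct) (cases b; auto)+

lemma nbwalk_path: "successively adj p \<Longrightarrow> distinct p \<Longrightarrow> nbwalk p"
  by (induction p rule: nbwalk.induct) auto

lemma nbwalk_successively: "nbwalk p \<Longrightarrow> successively adj p"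
  by (induction p rule: nbwalk.induct) auto

lemma nbwalk_nth: "nbwalk p \<Longrightarrow> Suc (Suc i) < length p \<Longrightarrow> p ! i \<noteq> p ! Suc (Suc i)"
proof (induction p arbitrary: i rule: nbwalk.induct)
  case (1 x y z r)
  then show ?case by (cases i) auto
qed auto

lemma nbwalk_distinct:
  assumes "\<nexists>p. circuit p" "nbwalk p"
  shows "distinct p"
  using nonbacktracking_distinct[OF assms(1) nbwalk_successively[OF assms(2)]] nbwalk_nth[OF assms(2)] by blast

section \<open>Leaves and longest paths in graphs without circuits\<close>

lemma successively_adj_verts:
  assumes "successively adj p" "2 \<le> length p"
  shows "set p \<subseteq> pverts G"
proof
  fix x assume "x \<in> set p"
  then obtain i where i: "i < length p" "x = p ! i" by (auto simp: in_set_conv_nth)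
  have step: "adj (p ! k) (p ! Suc k)" if "Suc k < length p" for k
    using assms(1) that by (simp add: successively_conv_nth)
  show "x \<in> pverts G"
  proof (cases i)
    case 0
    then show ?thesis using i step[of 0] adj_in_verts(1) assms(2) by auto
  next
    case (Suc k)
    then show ?thesis using i step[of k] adj_in_verts(2) by auto
  qed
qed

lemma path_length_le:
  assumes "successively adj p" "distinct p" "2 \<le> length p"
  shows "length p \<le> card (pverts G)"
  using successively_adj_verts[OF assms(1,3)] assms(2) pair_finite_verts
  by (metis card_mono distinct_card)

lemma leaf_iff: "leaf G l \<longleftrightarrow> (\<exists>s. \<forall>u. adj l u \<longleftrightarrow> u = s)"
proof -
  have "out_arcs (with_proj G) l = Pair l ` {u. adj l u}" by (auto simp: out_arcs_def)
  then have "out_degree (with_proj G) l = card {u. adj l u}"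
    by (simp add: out_degree_def card_image inj_on_def)
  moreover have "card {u. adj l u} = 1 \<longleftrightarrow> (\<exists>s. \<forall>u. adj l u \<longleftrightarrow> u = s)"
    by (auto simp: card_1_singleton_iff)
  moreover have "l \<in> pverts G" if "\<forall>u. adj l u \<longleftrightarrow> u = s" for s
    using that adj_in_verts(1)[of l s] by blast
  ultimately show ?thesis by (auto simp: leaf_def)
qed

text \<open>Without circuits non-backtracking walks are paths, so their length is bounded; a longest
  one starting with \<open>x\<close>, \<open>y\<close> ends in a leaf. Stating the start through
  \<open>take 2\<close> includes \<open>q = []\<close>, where \<open>y\<close> is the leaf.\<close>

lemma nbwalk_extend_to_leaf:
  assumes acyc: "\<nexists>p. circuit p" and "adj x y"
  obtains q s l where "nbwalk (q @ [s, l])" "take 2 (q @ [s, l]) = [x, y]" "\<forall>u. adj l u \<longleftrightarrow> u = s"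
proof -
  define P where "P r \<longleftrightarrow> nbwalk (x # y # r)" for r
  have "P []" using assms(2) by (simp add: P_def)
  moreover have "length r < Suc (card (pverts G))" if "P r" for r
    using path_length_le[OF nbwalk_successively nbwalk_distinct[OF acyc], of "x # y # r"] that
    by (simp add: P_def)
  ultimately obtain r where r: "P r" "\<And>r'. P r' \<Longrightarrow> length r' \<le> length r"
    using ex_has_greatest_nat[of P "[]" length "Suc (card (pverts G))"] by (auto simp: less_imp_le)
  obtain q s l where q: "x # y # r = q @ [s, l]"
  proof -
    have "x # y # r = butlast (butlast (x # y # r)) @ [last (butlast (x # y # r)), last (x # y # r)]"
      by (metis append.assoc append_Cons append_Nil append_butlast_last_id butlast.simps(2) list.distinct(1))
    then show thesis by (rule that)
  qed
  have nb: "nbwalk (q @ [s, l])" using r(1) q by (simp add: P_def)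
  have "adj s l" using nbwalk_successively[OF nb] by (simp add: successively_append_iff)
  have "u = s" if "adj l u" for u
  proof (rule ccontr)
    assume "u \<noteq> s"
    then have "nbwalk (q @ s # l # [u])" using nb that \<open>adj s l\<close> by (intro nbwalk_glue[of q s l "[u]"]) auto
    moreover have "q @ s # l # [u] = x # y # (r @ [u])" using q by (metis append.assoc append_Cons append_Nil)
    ultimately have "P (r @ [u])" by (simp add: P_def)
    then show False using r(2) by fastforce
  qed
  then have "\<forall>u. adj l u \<longleftrightarrow> u = s" using adj_sym[OF \<open>adj s l\<close>] by blast
  moreover have "take 2 (q @ [s, l]) = [x, y]" by (simp flip: q)
  ultimately show thesis using that[OF nb] by blast
qed

text \<open>Length at least 3 makes index 1 an inner position; in a star it coincides with
  \<open>length p - 2\<close>.\<close>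

definition longest_path :: "'a list \<Rightarrow> bool" where
  "longest_path p \<longleftrightarrow> successively adj p \<and> distinct p \<and> 3 \<le> length p \<and>
     (\<forall>q. successively adj q \<longrightarrow> distinct q \<longrightarrow> length q \<le> length p)"

lemma longest_path_rev: "longest_path p \<Longrightarrow> longest_path (rev p)"
  unfolding longest_path_def using adj_sym by (auto simp: successively_rev elim: successively_mono)

lemma longest_path_exists:
  assumes conn: "Digraph_Component.connected (with_proj G)" and V: "3 \<le> card (pverts G)"
  obtains p where "longest_path p"
proof -
  obtain u where u: "u \<in> pverts G" using V by fastforce
  have "{u} \<noteq> pverts G" using V by (intro notI) (auto dest: arg_cong[of _ _ card])
  then obtain v where v: "v \<in> pverts G - {u}" "adj u v"
    using connected_exit[OF conn, of "{u}"] u by blast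
  have "card {u, v} \<le> 2" by (simp add: card_insert_if)
  then have "{u, v} \<noteq> pverts G" using V by (intro notI) simp
  then obtain a w where w: "a \<in> {u, v}" "w \<in> pverts G - {u, v}" "adj a w"
    using connected_exit[OF conn, of "{u, v}"] u v by blast
  define P where "P q \<longleftrightarrow> successively adj q \<and> distinct q \<and> 3 \<le> length q" for q
  have "\<exists>q. P q"
  proof (cases "a = u")
    case True
    then show ?thesis using v w adj_sym[OF v(2)] by (intro exI[of _ "[v, u, w]"]) (auto simp: P_def)
  next
    case False
    then show ?thesis using v w by (intro exI[of _ "[u, v, w]"]) (auto simp: P_def)
  qed
  then obtain q0 where "P q0" by blast
  moreover have "length q < Suc (card (pverts G))" if "P q" for q
    using path_length_le[of q] that by (simp add: P_def)
  ultimately obtain p where p: "P p" "\<And>q. P q \<Longrightarrow> length q \<le> length p"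
    using ex_has_greatest_nat[of P q0 length "Suc (card (pverts G))"] by (auto simp: less_imp_le)
  have "longest_path p"
    unfolding longest_path_def
  proof (intro conjI allI impI)
    fix q assume "successively adj q" "distinct q"
    then show "length q \<le> length p" using p by (cases "3 \<le> length q") (auto simp: P_def)
  qed (use p in \<open>auto simp: P_def\<close>)
  then show thesis by (rule that)
qed

text \<open>Replacing the part of \<open>p\<close> after index \<open>i\<close> by the branch
  \<open>v # r\<close> gives a non-backtracking walk, hence a path, and it cannot be longer than
  \<open>p\<close>.\<close>

lemma off_path_walk:
  assumes acyc: "\<nexists>p. circuit p" and p: "longest_path p"
    and "i < length p" "v \<notin> set p" "nbwalk (p ! i # v # r)"
  shows "distinct (take i p @ p ! i # v # r)" "i + 2 + length r \<le> length p"
proof -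
  have lp: "successively adj p" "distinct p" using p by (auto simp: longest_path_def)
  have a: "adj (p ! i) v" using nbwalk_successively[OF assms(5)] by simp
  have t: "take i p @ [p ! i] = take (Suc i) p" using assms(3) by (simp add: take_Suc_conv_app_nth)
  have "successively adj (take (Suc i) p @ [v])"
  proof -
    have "successively adj (take (Suc i) p)" using lp(1) by (auto simp: successively_conv_nth)
    moreover have "last (take (Suc i) p) = p ! i" using t by (metis last_snoc)
    ultimately show ?thesis using a by (simp add: successively_append_iff)
  qed
  moreover have "distinct (take (Suc i) p @ [v])"
    using lp(2) assms(4) by (auto dest: in_set_takeD)
  ultimately have "nbwalk (take (Suc i) p @ [v])" by (rule nbwalk_path)
  then have "nbwalk (take i p @ [p ! i, v])" by (simp flip: t)
  then have nb: "nbwalk (take i p @ p ! i # v # r)" using assms(5) by (rule nbwalk_glue)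
  show d: "distinct (take i p @ p ! i # v # r)" using nbwalk_distinct[OF acyc nb] .
  have "length (take i p @ p ! i # v # r) \<le> length p"
    using p nbwalk_successively[OF nb] d unfolding longest_path_def by blast
  then show "i + 2 + length r \<le> length p" using assms(3) by simp
qed

lemma off_path_walk_rev:
  assumes acyc: "\<nexists>p. circuit p" and p: "longest_path p"
    and "i < length p" "v \<notin> set p" "nbwalk (p ! i # v # r)"
  shows "distinct (drop (Suc i) p @ p ! i # v # r)" "2 + length r \<le> Suc i"
proof -
  let ?j = "length p - Suc i"
  have j: "rev p ! ?j = p ! i" "?j < length (rev p)" using assms(3) by (simp_all add: rev_nth)
  have t: "take ?j (rev p) = rev (drop (Suc i) p)" using assms(3) by (simp add: take_rev)
  note off_path_walk[OF acyc longest_path_rev[OF p] j(2), unfolded j(1) t]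
  from this[of v r] show "distinct (drop (Suc i) p @ p ! i # v # r)" "2 + length r \<le> Suc i"
    using assms(3-5) by auto
qed

lemma longest_path_hd_leaf:
  assumes acyc: "\<nexists>p. circuit p" and p: "longest_path p"
  shows "adj (p ! 0) u \<longleftrightarrow> u = p ! 1"
proof
  have lp: "successively adj p" "distinct p" "3 \<le> length p" using p by (auto simp: longest_path_def)
  assume a: "adj (p ! 0) u"
  show "u = p ! 1"
  proof (cases "u \<in> set p")
    case True
    then obtain j where j: "j < length p" "u = p ! j" by (auto simp: in_set_conv_nth)
    have "j \<noteq> 0" using a j by (cases j) auto
    moreover have "\<not> 2 \<le> j" using circuit_sublist[OF lp(2,1), of 0 j] a j acyc by auto
    ultimately have "j = 1" by linarith
    then show ?thesis using j by simp
  next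
    case False
    moreover have "p \<noteq> []" using lp by auto
    ultimately show ?thesis using off_path_walk_rev(2)[OF acyc p, of 0 u "[]"] a by auto
  qed
next
  assume "u = p ! 1"
  then show "adj (p ! 0) u" using p by (auto simp: longest_path_def successively_conv_nth)
qed

text \<open>For a longest path of a tree this describes a path with double stars: all vertices off the path
  are leaves hanging on its second or its last but one vertex.\<close>

definition end_attached :: "'a list \<Rightarrow> bool" where
  "end_attached p \<longleftrightarrow> (\<forall>v i. v \<notin> set p \<longrightarrow> i < length p \<longrightarrow> adj (p ! i) v \<longrightarrow> i = 1 \<or> i = length p - 2)"

lemma off_path_index_bounds:
  assumes "\<nexists>p. circuit p" "longest_path p" "v \<notin> set p" "i < length p" "adj (p ! i) v"
  shows "1 \<le> i" "i + 2 \<le> length p"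
  using off_path_walk(2)[OF assms(1,2,4,3), of "[]"] off_path_walk_rev(2)[OF assms(1,2,4,3), of "[]"] assms(5)
  by auto

lemma longest_path_last_leaf:
  assumes acyc: "\<nexists>p. circuit p" and p: "longest_path p"
  shows "adj (p ! (length p - 1)) u \<longleftrightarrow> u = p ! (length p - 2)"
proof -
  have "0 < length p" "1 < length p" using p by (auto simp: longest_path_def)
  then have "rev p ! 0 = p ! (length p - 1)" "rev p ! 1 = p ! (length p - 2)"
    by (simp_all add: rev_nth numeral_2_eq_2)
  then show ?thesis using longest_path_hd_leaf[OF acyc longest_path_rev[OF p], of u] by simp
qed

text \<open>A vertex hanging at distance at least 2 from both ends of \<open>p\<close> is the extra
  leg of a spider along \<open>p\<close>; the required nonadjacencies hold because a chord of
  \<open>p\<close> would close a circuit.\<close>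

lemma mengerian_imp_end_attached:
  assumes m: "mengerian (pverts G) (H3 G)" and acyc: "\<nexists>p. circuit p" and p: "longest_path p"
  shows "end_attached p"
  unfolding end_attached_def
proof (intro allI impI, rule ccontr)
  fix v i assume v: "v \<notin> set p" "i < length p" "adj (p ! i) v" and no: "\<not> (i = 1 \<or> i = length p - 2)"
  have lp: "successively adj p" "distinct p" using p by (auto simp: longest_path_def)
  have i: "2 \<le> i" "i + 2 < length p" using off_path_index_bounds[OF acyc p v] no by linarith+
  have step: "adj (p ! k) (p ! Suc k)" if "Suc k < length p" for k
    using lp(1) that by (simp add: successively_conv_nth)
  have chord: "\<not> adj (p ! j) (p ! k)" if "j + 2 \<le> k" "k < length p" for j k
    using circuit_sublist[OF lp(2,1) that] acyc by blast
  have "\<not> mengerian (pverts G) (H3 G)"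
  proof (rule not_mengerian_spider[of "p ! (i - 2)" "p ! (i - 1)" "p ! i" "p ! (i + 1)" "p ! (i + 2)" v])
    have "p ! j \<noteq> v" if "j < length p" for j using v(1) that by auto
    then show "distinct [p ! (i - 2), p ! (i - 1), p ! i, p ! (i + 1), p ! (i + 2), v]"
      using i lp(2) by (auto simp: nth_eq_iff_index_eq)
    show "adj (p ! (i - 2)) (p ! (i - 1))" using step[of "i - 2"] i by (simp add: Suc_diff_Suc numeral_2_eq_2)
    show "adj (p ! (i - 1)) (p ! i)" using step[of "i - 1"] i by simp
    show "adj (p ! i) (p ! (i + 1))" "adj (p ! (i + 1)) (p ! (i + 2))" using step[of i] step[of "i + 1"] i by simp_all
    show "\<not> adj (p ! i) (p ! (i - 2))" using chord[of "i - 2" i] i adj_sym[of "p ! i" "p ! (i - 2)"] by fastforce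
    show "\<not> adj (p ! i) (p ! (i + 2))" using chord[of i "i + 2"] i by simp
    show "\<not> adj (p ! (i - 2)) (p ! (i + 2))" using chord[of "i - 2" "i + 2"] i by simp
  qed (rule v(3))
  then show False using m by simp
qed

text \<open>Following a branch at a forbidden index \<open>i\<close> to a leaf produces a vertex
  \<open>s\<close> adjacent to it, on the branch or equal to \<open>p ! i\<close>. The ends of
  \<open>p\<close> are leaves too, so \<open>s\<close>, \<open>p ! 1\<close> and
  \<open>p ! (length p - 2)\<close> are three vertices adjacent to leaves.\<close>

lemma few_supports_imp_end_attached:
  assumes few: "card {v \<in> pverts G. \<exists>l. leaf G l \<and> adj v l} \<le> 2"
    and acyc: "\<nexists>p. circuit p" and p: "longest_path p"
  shows "end_attached p"
  unfolding end_attached_def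
proof (intro allI impI, rule ccontr)
  fix v i assume v: "v \<notin> set p" "i < length p" "adj (p ! i) v" and no: "\<not> (i = 1 \<or> i = length p - 2)"
  let ?S = "{v \<in> pverts G. \<exists>l. leaf G l \<and> adj v l}"
  have lp: "distinct p" using p by (auto simp: longest_path_def)
  have i: "2 \<le> i" "i + 2 < length p" using off_path_index_bounds[OF acyc p v] no by linarith+
  have supp: "s \<in> ?S" if "\<And>u. adj l u \<longleftrightarrow> u = s" for l s
  proof -
    have "adj l s" "leaf G l" using that by (auto simp: leaf_iff)
    then show ?thesis using adj_sym[of l s] adj_in_verts(2)[of l s] by blast
  qed
  obtain q s l where q: "nbwalk (q @ [s, l])" "take 2 (q @ [s, l]) = [p ! i, v]" "\<forall>u. adj l u \<longleftrightarrow> u = s"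
    by (rule nbwalk_extend_to_leaf[OF acyc v(3)])
  define r where "r = drop 2 (q @ [s, l])"
  have r: "q @ [s, l] = p ! i # v # r"
    using append_take_drop_id[of 2 "q @ [s, l]"] unfolding q(2) r_def[symmetric] by simp
  have d: "distinct (take i p @ p ! i # v # r)" "distinct (drop (Suc i) p @ p ! i # v # r)"
    using off_path_walk(1)[OF acyc p v(2,1)] off_path_walk_rev(1)[OF acyc p v(2,1)] q(1)[unfolded r] by blast+
  have "s = p ! i \<or> s \<in> set (v # r)"
  proof -
    have "s \<in> set (q @ [s, l])" by simp
    then show ?thesis unfolding r by auto
  qed
  moreover have "p ! 1 \<in> set (take i p)" using i by (auto simp: in_set_conv_nth intro!: exI[of _ 1])
  moreover have "p ! (length p - 2) \<in> set (drop (Suc i) p)"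
  proof -
    have eq: "Suc i + (length p - 2 - Suc i) = length p - 2" using i by linarith
    have "drop (Suc i) p ! (length p - 2 - Suc i) = p ! (length p - 2)"
      using nth_drop[of "Suc i" p "length p - 2 - Suc i"] i unfolding eq by simp
    then show ?thesis using i nth_mem[of "length p - 2 - Suc i" "drop (Suc i) p"] by simp
  qed
  ultimately have "s \<noteq> p ! 1" "s \<noteq> p ! (length p - 2)" using d by auto
  moreover have "p ! 1 \<noteq> p ! (length p - 2)" using i lp by (simp add: nth_eq_iff_index_eq)
  ultimately have "card {s, p ! 1, p ! (length p - 2)} = 3" by simp
  moreover have "{s, p ! 1, p ! (length p - 2)} \<subseteq> ?S"
    using supp[OF q(3)[rule_format]] supp[OF longest_path_hd_leaf[OF acyc p]] supp[OF longest_path_last_leaf[OF acyc p]]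
    by blast
  then have "card {s, p ! 1, p ! (length p - 2)} \<le> card ?S"
    using pair_finite_verts by (intro card_mono) auto
  ultimately show False using few by linarith
qed

text \<open>Beyond \<open>p ! i\<close> there is room for only one vertex on the side of the nearer
  end; a second neighbour of \<open>v\<close> would yield a path longer than
  \<open>p\<close>.\<close>

lemma end_attached_unique_neighbour:
  assumes acyc: "\<nexists>p. circuit p" and p: "longest_path p" "end_attached p"
    and v: "v \<notin> set p" "i < length p" "adj (p ! i) v" and u: "adj v u"
  shows "u = p ! i"
proof (rule ccontr)
  assume "u \<noteq> p ! i"
  then have nb: "nbwalk (p ! i # v # [u])" using v(3) u by auto
  have "i = 1 \<or> i = length p - 2" using p(2) v by (auto simp: end_attached_def)
  then show False
    using off_path_walk(2)[OF acyc p(1) v(2,1) nb] off_path_walk_rev(2)[OF acyc p(1) v(2,1) nb] by auto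
qed

lemma end_attached_cover:
  assumes acyc: "\<nexists>p. circuit p" and p: "longest_path p" "end_attached p"
    and conn: "Digraph_Component.connected (with_proj G)" and v: "v \<in> pverts G" "v \<notin> set p"
  shows "adj v (p ! 1) \<or> adj v (p ! (length p - 2))"
proof -
  let ?A = "set p \<union> {v. \<exists>i<length p. adj (p ! i) v}"
  have lp: "successively adj p" "3 \<le> length p" using p by (auto simp: longest_path_def)
  have "?A = pverts G"
  proof (rule connected_closed[OF conn])
    show "p ! 0 \<in> ?A" using lp(2) by (cases p) auto
    show "?A \<subseteq> pverts G" using successively_adj_verts[OF lp(1)] lp(2) adj_in_verts by auto
    fix u w assume uw: "u \<in> ?A" "adj u w"
    show "w \<in> ?A"
    proof (cases "u \<in> set p")
      case True
      then show ?thesis using uw(2) by (auto simp: in_set_conv_nth)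
    next
      case False
      then obtain i where i: "i < length p" "adj (p ! i) u" using uw(1) by blast
      then have "w = p ! i" using end_attached_unique_neighbour[OF acyc p False i uw(2)] by simp
      then show ?thesis using i by simp
    qed
  qed
  then obtain i where i: "i < length p" "adj (p ! i) v" using v by blast
  then have "i = 1 \<or> i = length p - 2" using p(2) v by (auto simp: end_attached_def)
  then show ?thesis using adj_sym[OF i(2)] by auto
qed

text \<open>Inner vertices of \<open>p\<close> have two neighbours on it, so a leaf is an end of
  \<open>p\<close> or lies off \<open>p\<close>; in both cases it hangs on \<open>p ! 1\<close> or
  \<open>p ! (length p - 2)\<close>.\<close>

lemma end_attached_imp_few_supports:
  assumes acyc: "\<nexists>p. circuit p" and p: "longest_path p" "end_attached p"
    and conn: "Digraph_Component.connected (with_proj G)"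
  shows "card {v \<in> pverts G. \<exists>l. leaf G l \<and> adj v l} \<le> 2"
proof -
  have lp: "successively adj p" "distinct p" "3 \<le> length p" using p by (auto simp: longest_path_def)
  have "v \<in> {p ! 1, p ! (length p - 2)}" if vl: "leaf G l" "adj v l" for v l
  proof -
    obtain s where s: "\<And>u. adj l u \<longleftrightarrow> u = s" using vl(1) by (auto simp: leaf_iff)
    have v: "v = s" using s adj_sym[OF vl(2)] by blast
    show ?thesis
    proof (cases "l \<in> set p")
      case False
      then show ?thesis using end_attached_cover[OF acyc p conn adj_in_verts(2)[OF vl(2)]] s v by auto
    next
      case True
      then obtain j where j: "j < length p" "l = p ! j" by (auto simp: in_set_conv_nth)
      consider "j = 0" | "j = length p - 1" | "0 < j" "Suc j < length p" using j(1) by linarith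
      then show ?thesis
      proof cases
        case 1
        then show ?thesis using longest_path_hd_leaf[OF acyc p(1)] s v j by auto
      next
        case 2
        then show ?thesis using longest_path_last_leaf[OF acyc p(1)] s v j by auto
      next
        case 3
        have step: "adj (p ! k) (p ! Suc k)" if "Suc k < length p" for k
          using lp(1) that by (simp add: successively_conv_nth)
        have "adj l (p ! Suc j)" "adj l (p ! (j - 1))"
          using step[of j] adj_sym[OF step[of "j - 1"]] j 3 by auto
        then have "p ! Suc j = p ! (j - 1)" using s by simp
        then show ?thesis using lp(2) 3 by (simp add: nth_eq_iff_index_eq)
      qed
    qed
  qed
  then have "{v \<in> pverts G. \<exists>l. leaf G l \<and> adj v l} \<subseteq> {p ! 1, p ! (length p - 2)}" by blast
  then have "card {v \<in> pverts G. \<exists>l. leaf G l \<and> adj v l} \<le> card {p ! 1, p ! (length p - 2)}"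
    by (intro card_mono) auto
  also have "\<dots> \<le> 2" by (simp add: card_insert_if)
  finally show ?thesis .
qed

text \<open>A path cannot turn back at an inner vertex: its two neighbours there would share a
  layer, yet one of them is itself inner and has two neighbours, against \<open>same\<close>. Hence
  positions along a path on four vertices are strictly monotone. Conversely, consecutive layers are
  completely joined.\<close>

lemma H3_layered:
  fixes pos :: "'a \<Rightarrow> nat"
  assumes adj_iff: "\<And>u v. u \<in> pverts G \<Longrightarrow> v \<in> pverts G \<Longrightarrow>
      adj u v \<longleftrightarrow> pos u = Suc (pos v) \<or> pos v = Suc (pos u)"
    and same: "\<And>u v a b. u \<in> pverts G \<Longrightarrow> v \<in> pverts G \<Longrightarrow> u \<noteq> v \<Longrightarrow> pos u = pos v \<Longrightarrow>
      adj u a \<Longrightarrow> adj u b \<Longrightarrow> a = b"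
  shows "H3 G = {e. e \<subseteq> pverts G \<and> (\<exists>i. bij_betw pos e {i..<i + 4})}"
proof (intro equalityI subsetI)
  fix e assume e: "e \<in> H3 G"
  obtain a b c d where p: "e = {a, b, c, d}" "adj a b" "adj b c" "adj c d" "distinct [a, b, c, d]"
    using H3_E[OF e] .
  have V: "a \<in> pverts G" "b \<in> pverts G" "c \<in> pverts G" "d \<in> pverts G"
    using p(2-4) adj_in_verts by blast+
  have ac: "pos a \<noteq> pos c" using same[OF V(3,1) _ _ adj_sym[OF p(3)] p(4)] p(5) by auto
  have bd: "pos b \<noteq> pos d" using same[OF V(2,4) _ _ adj_sym[OF p(2)] p(3)] p(5) by auto
  have steps: "pos a = Suc (pos b) \<or> pos b = Suc (pos a)" "pos b = Suc (pos c) \<or> pos c = Suc (pos b)"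
      "pos c = Suc (pos d) \<or> pos d = Suc (pos c)"
    using p(2-4) adj_iff V by blast+
  have w: "{i..<i + 4} = {i, i + 1, i + 2, i + 3}" for i :: nat by auto
  have bij: "bij_betw pos e {i..<i + 4}" if "pos ` e = {i, i + 1, i + 2, i + 3}" for i
  proof -
    have "finite e" "card (pos ` e) = card e" using p(1) that H3_card[OF e] by auto
    then have "inj_on pos e" by (rule eq_card_imp_inj_on)
    then show ?thesis using that by (simp add: bij_betw_def w)
  qed
  have "\<exists>i. bij_betw pos e {i..<i + 4}"
  proof (cases "pos b = Suc (pos a)")
    case True
    then have "pos c = pos a + 2" "pos d = pos a + 3" "pos b = pos a + 1" using steps ac bd by linarith+
    then have "bij_betw pos e {pos a..<pos a + 4}" by (intro bij) (simp add: p(1))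
    then show ?thesis by blast
  next
    case False
    then have "pos c = pos d + 1" "pos b = pos d + 2" "pos a = pos d + 3" using steps ac bd by linarith+
    then have "bij_betw pos e {pos d..<pos d + 4}" by (intro bij) (simp add: p(1) insert_commute)
    then show ?thesis by blast
  qed
  then show "e \<in> {e. e \<subseteq> pverts G \<and> (\<exists>i. bij_betw pos e {i..<i + 4})}"
    using e H3_subset by blast
next
  fix e assume "e \<in> {e. e \<subseteq> pverts G \<and> (\<exists>i. bij_betw pos e {i..<i + 4})}"
  then obtain i where e: "e \<subseteq> pverts G" "bij_betw pos e {i..<i + 4}" by blast
  define g where "g = the_inv_into e pos"
  have inj: "inj_on pos e" and im: "pos ` e = {i..<i + 4}" using e(2) by (auto simp: bij_betw_def)
  have pg: "pos (g k) = k" "g k \<in> pverts G" if "k \<in> {i..<i + 4}" for k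
  proof -
    have k: "k \<in> pos ` e" unfolding im by (rule that)
    show "pos (g k) = k" unfolding g_def by (rule f_the_inv_into_f[OF inj k])
    show "g k \<in> pverts G" using the_inv_into_into[OF inj k] e(1) unfolding g_def by blast
  qed
  have "e = g ` {i..<i + 4}" unfolding g_def using inj im by (metis the_inv_into_onto)
  also have "{i..<i + 4} = {i, i + 1, i + 2, i + 3}" by auto
  finally have "e = {g i, g (i + 1), g (i + 2), g (i + 3)}" by simp
  moreover have "{g i, g (i + 1), g (i + 2), g (i + 3)} \<in> H3 G"
  proof (rule H3_I)
    show "adj (g i) (g (i + 1))" "adj (g (i + 1)) (g (i + 2))" "adj (g (i + 2)) (g (i + 3))"
      using adj_iff pg by auto
    have "g j \<noteq> g k" if "j \<in> {i..<i + 4}" "k \<in> {i..<i + 4}" "j \<noteq> k" for j k using pg that by metis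
    then show "distinct [g i, g (i + 1), g (i + 2), g (i + 3)]" by simp
  qed
  ultimately show "e \<in> H3 G" by simp
qed

lemma end_attached_imp_mengerian:
  assumes acyc: "\<nexists>p. circuit p" and p: "longest_path p" "end_attached p"
    and conn: "Digraph_Component.connected (with_proj G)"
  shows "mengerian (pverts G) (H3 G)"
proof -
  have lp: "successively adj p" "distinct p" "3 \<le> length p" using p by (auto simp: longest_path_def)
  define m where "m = length p - 1"
  have m: "2 \<le> m" "length p = Suc m" "length p - 2 = m - 1" using lp(3) by (auto simp: m_def)
  define idx where "idx = the_inv_into {..<length p} ((!) p)"
  have idx: "idx (p ! i) = i" if "i \<le> m" for i
    unfolding idx_def using that m(2) lp(2) by (intro the_inv_into_f_f) (auto simp: inj_on_nth)
  \<comment> \<open>A leaf off \<open>p\<close> shares the layer of the end of \<open>p\<close>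
    hanging on the same vertex. For \<open>m = 2\<close> both ends qualify, and layer 0 is
    taken.\<close>
  define pos where "pos v = (if v \<in> set p then idx v else if adj v (p ! 1) then 0 else m)" for v
  have on: "pos (p ! i) = i" if "i \<le> m" for i using that idx m(2) by (simp add: pos_def)
  have inP: "\<exists>i\<le>m. v = p ! i" if "v \<in> set p" for v
    using that m(2) by (auto simp: in_set_conv_nth less_Suc_eq_le)
  have off: "pos v = 0 \<and> (\<forall>u. adj v u \<longleftrightarrow> u = p ! 1) \<or> pos v = m \<and> (\<forall>u. adj v u \<longleftrightarrow> u = p ! (m - 1))"
    if v: "v \<in> pverts G" "v \<notin> set p" for v
  proof -
    have uniq: "u = p ! i" if "adj v (p ! i)" "adj v u" "i \<le> m" for u i
      using end_attached_unique_neighbour[OF acyc p v(2) _ adj_sym[OF that(1)] that(2)] that(3) m(2) by auto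
    show ?thesis
    proof (cases "adj v (p ! 1)")
      case True
      moreover have "1 \<le> m" using m(1) by simp
      ultimately have "\<forall>u. adj v u \<longleftrightarrow> u = p ! 1" using uniq[of 1] by blast
      moreover have "pos v = 0" using True v by (simp add: pos_def)
      ultimately show ?thesis by blast
    next
      case False
      then have "adj v (p ! (m - 1))" using end_attached_cover[OF acyc p conn v] m(3) by auto
      moreover have "m - 1 \<le> m" by simp
      ultimately have "\<forall>u. adj v u \<longleftrightarrow> u = p ! (m - 1)" using uniq[of "m - 1"] by blast
      moreover have "pos v = m" using False v by (simp add: pos_def)
      ultimately show ?thesis by blast
    qed
  qed
  have PP: "adj (p ! i) (p ! j) \<longleftrightarrow> i = Suc j \<or> j = Suc i" if "i \<le> m" "j \<le> m" for i j
  proof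
    assume a: "adj (p ! i) (p ! j)"
    have chord: "\<not> adj (p ! j) (p ! k)" if "j + 2 \<le> k" "k \<le> m" for j k
      using circuit_sublist[OF lp(2,1), of j k] acyc that m(2) by auto
    have "i \<noteq> j" using a by auto
    then show "i = Suc j \<or> j = Suc i" using chord[of i j] chord[of j i] a adj_sym[OF a] that by linarith
  next
    have step: "adj (p ! k) (p ! Suc k)" if "k < m" for k
      using lp(1) that m(2) by (simp add: successively_conv_nth)
    assume "i = Suc j \<or> j = Suc i"
    then show "adj (p ! i) (p ! j)" using step adj_sym that by auto
  qed
  have PO: "adj v (p ! i) \<longleftrightarrow> pos v = Suc i \<or> i = Suc (pos v)"
    if v: "v \<in> pverts G" "v \<notin> set p" and i: "i \<le> m" for v i
  proof -
    have eq: "p ! i = p ! j \<longleftrightarrow> i = j" if "j \<le> m" for j using on[OF i] on[OF that] by metis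
    from off[OF v] show ?thesis
    proof (elim disjE conjE)
      assume "pos v = 0" "\<forall>u. adj v u \<longleftrightarrow> u = p ! 1"
      then show ?thesis using eq[of 1] m(1) by simp
    next
      assume *: "pos v = m" "\<forall>u. adj v u \<longleftrightarrow> u = p ! (m - 1)"
      then have "adj v (p ! i) \<longleftrightarrow> i = m - 1" using eq[of "m - 1"] by simp
      then show ?thesis unfolding *(1) using m(1) i by linarith
    qed
  qed
  have adj_iff: "adj u v \<longleftrightarrow> pos u = Suc (pos v) \<or> pos v = Suc (pos u)"
    if uv: "u \<in> pverts G" "v \<in> pverts G" for u v
  proof (cases "u \<in> set p"; cases "v \<in> set p")
    assume "u \<in> set p" "v \<in> set p"
    then show ?thesis using inP PP on by metis
  next
    assume a: "u \<in> set p" "v \<notin> set p"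
    then obtain i where "i \<le> m" "u = p ! i" using inP by blast
    then show ?thesis using PO[OF uv(2) a(2), of i] on adj_sym by metis
  next
    assume a: "u \<notin> set p" "v \<in> set p"
    then obtain i where "i \<le> m" "v = p ! i" using inP by blast
    then show ?thesis using PO[OF uv(1) a(1), of i] on by metis
  next
    assume a: "u \<notin> set p" "v \<notin> set p"
    have "p ! 1 \<in> set p" "p ! (m - 1) \<in> set p" using m by auto
    then have "\<not> adj u v" using off[OF uv(1) a(1)] a(2) by metis
    moreover have "pos u = 0 \<or> pos u = m" "pos v = 0 \<or> pos v = m" using off uv a by blast+
    then have "\<not> (pos u = Suc (pos v) \<or> pos v = Suc (pos u))" using m(1) by linarith
    ultimately show ?thesis by blast
  qed
  have same: "a = b" if "u \<in> pverts G" "v \<in> pverts G" "u \<noteq> v" "pos u = pos v" "adj u a" "adj u b" for u v a b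
  proof (cases "u \<in> set p")
    case False
    then show ?thesis using off[OF that(1) False] that(5,6) by metis
  next
    case True
    then obtain i where i: "i \<le> m" "u = p ! i" using inP by blast
    \<comment> \<open>Positions on \<open>p\<close> are distinct, so \<open>v\<close> is off
      \<open>p\<close> and its layer is 0 or \<open>m\<close>; thus \<open>u\<close> is an end of
      \<open>p\<close> and a leaf.\<close>
    have "v \<notin> set p" using inP on that(3,4) i by metis
    then have "i = 0 \<or> i = m" using off[OF that(2)] that(4) i on by metis
    then show ?thesis
      using longest_path_hd_leaf[OF acyc p(1)] longest_path_last_leaf[OF acyc p(1)] i that(5,6) m_def by metis
  qed
  have "H3 G = {e. e \<subseteq> pverts G \<and> (\<exists>i. bij_betw pos e {i..<i + 4})}"
    using adj_iff same by (rule H3_layered)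
  then show ?thesis using mengerian_windows[OF pair_finite_verts, of 4 pos] by simp
qed

text \<open>A shortest circuit decides: length 3 gives the star, length 4 is impossible, and from 5
  on minimality makes it induced, so it has length 8 and spans the graph.\<close>

lemma mengerian_not_tree:
  assumes conn: "Digraph_Component.connected (with_proj G)" and V: "5 \<le> card (pverts G)"
    and m: "mengerian (pverts G) (H3 G)" and "\<exists>p. circuit p"
  shows "digraph_iso (with_proj G) (with_proj (cycle_graph 8)) \<or> star_with_extra_edge G"
proof -
  obtain p where p: "circuit p" "\<And>q. circuit q \<Longrightarrow> length p \<le> length q"
    using assms(4) ex_has_least_nat[of circuit _ length] by blast
  have circ: "3 \<le> length p" "distinct p" "successively adj p" "adj (last p) (hd p)"
    using p(1) by (auto simp: circuit_def)
  consider "length p = 3" | "length p = 4" | "5 \<le> length p" using circ(1) by linarith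
  then show ?thesis
  proof cases
    case 1
    then obtain a b c where "p = [a, b, c]"
      by (auto simp: eval_nat_numeral length_Suc_conv)
    then show ?thesis
      using mengerian_triangle_imp_star_with_extra_edge[OF conn V m, of a b c] circ by auto
  next
    case 2
    then obtain a b c d where "p = [a, b, c, d]"
      by (auto simp: eval_nat_numeral length_Suc_conv)
    then show ?thesis using mengerian_no_C4[OF conn V m, of a b c d] circ by auto
  next
    case 3
    define v where "v = (\<lambda>k. p ! nat (k mod int (length p)))"
    have cyc: "induced_cycle (int (length p)) v"
      unfolding v_def
      by (rule circuit_chordless_induced_cycle[OF p(1)]) (rule shortest_circuit_chordless[OF p])
    then have "int (length p) = 8" using mengerian_induced_cycle_imp_eq_8[OF m cyc] 3 by simp
    then have "induced_cycle 8 v" using cyc by simp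
    then show ?thesis
      using induced_C8_imp_digraph_iso mengerian_induced_C8_spanning[OF conn m] by blast
  qed
qed

end

theorem theorem3p13:
  fixes G :: "'a pair_pre_digraph"
  assumes "pair_graph G"
    and "Digraph_Component.connected (with_proj G)"
    and "card (pverts G) \<ge> 4"
  shows "mengerian (pverts G) (H3 G) \<longleftrightarrow>
           card (pverts G) = 4 \<or>
           digraph_iso (with_proj G) (with_proj (cycle_graph 8)) \<or>
           path_with_double_stars G \<or>
           star_with_extra_edge G"
proof -
  interpret pair_graph G by fact
  have tree: "undirected_tree G \<longleftrightarrow> (\<nexists>p. circuit p)"
    using assms(1,2) cycle_iff_circuit by (auto simp: undirected_tree_def)
  obtain p where p: "longest_path p" using longest_path_exists[OF assms(2)] assms(3) by auto
  show ?thesis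
  proof
    assume m: "mengerian (pverts G) (H3 G)"
    show "card (pverts G) = 4 \<or> digraph_iso (with_proj G) (with_proj (cycle_graph 8)) \<or>
        path_with_double_stars G \<or> star_with_extra_edge G"
    proof (cases "\<exists>p. circuit p")
      case True
      moreover have "card (pverts G) = 4 \<or> 5 \<le> card (pverts G)" using assms(3) by linarith
      ultimately show ?thesis using mengerian_not_tree[OF assms(2) _ m] by blast
    next
      case False
      then have "card {v \<in> pverts G. \<exists>l. leaf G l \<and> adj v l} \<le> 2"
        using end_attached_imp_few_supports[OF False p mengerian_imp_end_attached[OF m False p] assms(2)]
        by simp
      then show ?thesis using tree False by (simp add: path_with_double_stars_def)
    qed
  next
    assume "card (pverts G) = 4 \<or> digraph_iso (with_proj G) (with_proj (cycle_graph 8)) \<or>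
        path_with_double_stars G \<or> star_with_extra_edge G"
    then show "mengerian (pverts G) (H3 G)"
    proof (elim disjE)
      assume "card (pverts G) = 4"
      then show ?thesis by (rule mengerian_four_vertices)
    next
      assume "digraph_iso (with_proj G) (with_proj (cycle_graph 8))"
      then show ?thesis
        using digraph_iso_C8_imp_induced_cycle mengerian_spanning_induced_C8 by blast
    next
      assume "path_with_double_stars G"
      then have acyc: "\<nexists>p. circuit p" and few: "card {v \<in> pverts G. \<exists>l. leaf G l \<and> adj v l} \<le> 2"
        using tree by (auto simp: path_with_double_stars_def)
      show ?thesis
        using end_attached_imp_mengerian[OF acyc p few_supports_imp_end_attached[OF few acyc p] assms(2)] .
    next
      assume "star_with_extra_edge G"
      then show ?thesis by (rule star_with_extra_edge_imp_mengerian)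
    qed
  qed
qed

end
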